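(* Let $f=g+h$ where $g:\mathbb{R}^d\to\mathbb{R}$ is $\rho$-weakly convex ($\rho>0$) and $h$ is the indicator function of a nonempty closed convex set $\mathcal{X}\subseteq\mathbb{R}^d$. Suppose there are $c>0$ and $\theta\in[1/2,1]$ such that $\|\nabla f_{1/(2\rho)}(x)\|\ge c\,(f_{1/(2\rho)}(x)-f^* )^{\theta}$ for all $x\in V$. Let $x_0\in\mathcal{X}$, $\Delta_0=f_{1/(2\rho)}(x_0)-f^*>0$ and $C=16c^{-4}\Delta_0^{1-4\theta}\rho L^2$. For each $T\in\mathbb{N}^*$ let $$N^*=N^*(T)=\operatorname*{argmin}_{x\in\mathbb{R}_+}\ \Delta_0\left(\frac{Cx}{T}\right)^{\frac{1-(4\theta)^{-x}}{4\theta-1}}.$$ Then, as $T\to+\infty$ (all other quantities being fixed), $$N^*\sim\frac{\log\log(T/C)}{\log(4\theta)}.$$ Moreover, let $x_{N^*}$ denote the output after $N^*$ outer iterations of the constant-step restart scheme with total inner-iteration budget $T$, that is, with $T/N^*$ inner iterations per outer iteration ($N^*$ and $T/N^*$ being rounded to integers as specified in the context). Then $$\mathbb{E}[f_{1/(2\rho)}(x_{N^*})]-f^*\ \lesssim\ \Delta_0\left(\frac{C\log\log(T/C)}{T\log(4\theta)}\right)^{1/(4\theta-1)}$$ and $$\mathbb{E}[\|\nabla f_{1/(2\rho)}(x_{N^*})\|^2]^{1/2}\ \lesssim\ \|\nabla f_{1/(2\rho)}(x_0)\|\left(\frac{C\log\log(T/C)}{T\log(4\theta)}\right)^{\theta/(4\theta-1)}$$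 as $T\to+\infty$.
   Context: A function $g$ is $\rho$-weakly convex if $x\mapsto g(x)+\frac{\rho}{2}\|x\|^2$ is convex. $f^*=\inf_{\mathbb{R}^d} f$ is assumed finite. The Moreau envelope is $f_\lambda(x)=\min_y\{f(y)+\frac{1}{2\lambda}\|y-x\|^2\}$; for $0<\lambda<\rho^{-1}$ it is $C^1$, with $\nabla f_\lambda(x)=\lambda^{-1}(x-\operatorname{prox}_{\lambda f}(x))$ and $\operatorname{prox}_{\lambda f}(x)$ the minimizer in its definition. Here $\lambda=1/(2\rho)$. Stochastic oracle: $L>0$, and $G(x,\xi)$ is a random vector ($\xi$ random) with $\mathbb{E}_\xi[G(x,\xi)]\in\partial g(x)$ (Fréchet subdifferential) and $\mathbb{E}_\xi[\|G(x,\xi)\|^2]\le L^2$ for all $x\in\mathcal{X}$. Projected stochastic subgradient method started at $y_0$, with $n$ iterations and constant step size $\alpha$: for $s=0,\dots,n-1$, draw a fresh independent sample $\xi_s$ and set $y_{s+1}=\mathrm{proj}_{\mathcal{X}}(y_s-\alpha G(y_s,\xi_s))$; then draw $s^*$ uniformly from $\{0,\dots,n\}$, independently of everything else, and output $y_{s^*}$. Constant-step restart scheme with $N$ outer iterations and $t\ge1$ inner iterations: for $k=0,\dots,N-1$, $x_{k+1}$ is the output of the projected stochastic subgradient method started at $x_k$, run for $t$ iterations with constant step size $\alpha=\frac{(f_{1/(2\rho)}(x_k)-f^* )^{1/2}}{\sqrt{\rho}\,L\sqrt{t+1}}$. All samples and output indices are independent across inner and outer iterations. The scheme's output is $x_N$.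 Rounding convention: "$N^*$ outer iterations with budget $T$" means $N=\lceil N^*\rceil$ and $t=\lfloor T/N\rfloor$ (which is $\ge1$ for $T$ large), and $x_{N^*}$ means the resulting $x_N$. $V\subseteq\mathbb{R}^d$ is a set containing $x_0$ and, almost surely, all outer iterates $x_k$ (for instance $V=\mathbb{R}^d$). In the definition of $N^*$ the function being minimized is given the value $\Delta_0$ at $x=0$ (convention $0^0=1$), and the minimizer exists and is unique. Notation: $a_T\sim b_T$ means $a_T/b_T\to1$; $a_T\lesssim b_T$ means $a_T\le u_T$ for all large $T$, for some sequence $u_T\sim b_T$. *)

theory Defs
  imports "HOL-Probability.Probability" "HOL-Library.Landau_Symbols"
begin

definition weakly_convex :: "real \<Rightarrow> ('a::real_inner \<Rightarrow> real) \<Rightarrow> bool" where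
  "weakly_convex \<rho> g \<longleftrightarrow> convex_on UNIV (\<lambda>x. g x + \<rho> / 2 * (norm x)\<^sup>2)"

definition convex_indicator :: "'a set \<Rightarrow> 'a \<Rightarrow> ereal" where
  "convex_indicator X x = (if x \<in> X then 0 else \<infinity>)"

definition frechet_subdiff :: "('a::real_inner \<Rightarrow> real) \<Rightarrow> 'a \<Rightarrow> 'a set" where
  "frechet_subdiff g x =
     {v. 0 \<le> Liminf (at x) (\<lambda>y. ereal ((g y - g x - v \<bullet> (y - x)) / norm (y - x)))}"

text \<open>The infimum below is finite whenever \<open>f\<close> is bounded below and not identically \<open>\<infinity>\<close>,
  so the conversion to a real number loses nothing there. It is a minimum when moreover
  \<open>f\<close> is lower semicontinuous on a Euclidean space and \<open>lam > 0\<close>.\<close>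

definition moreau_env :: "real \<Rightarrow> ('a::real_normed_vector \<Rightarrow> ereal) \<Rightarrow> 'a \<Rightarrow> real" where
  "moreau_env lam f x =
     real_of_ereal (INF y. f y + ereal (1 / (2 * lam) * (norm (y - x))\<^sup>2))"

definition gradient :: "('a::real_inner \<Rightarrow> real) \<Rightarrow> 'a \<Rightarrow> 'a" where
  "gradient F x = (THE D. GDERIV F x :> D)"

primrec proj_subgrad ::
  "'a::euclidean_space set \<Rightarrow> ('a \<Rightarrow> 'b \<Rightarrow> 'a) \<Rightarrow> real \<Rightarrow> 'a \<Rightarrow> (nat \<Rightarrow> 'b) \<Rightarrow> nat \<Rightarrow> 'a" where
  "proj_subgrad X G \<alpha> y\<^sub>0 z 0 = y\<^sub>0"
| "proj_subgrad X G \<alpha> y\<^sub>0 z (Suc s) =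
     closest_point X (proj_subgrad X G \<alpha> y\<^sub>0 z s
                        - \<alpha> *\<^sub>R G (proj_subgrad X G \<alpha> y\<^sub>0 z s) (z s))"

text \<open>Outer iterates of a restart scheme: \<open>\<alpha> x\<close> is the constant step size used by the inner
  run started at \<open>x\<close>, \<open>z k s\<close> is the sample drawn in inner iteration \<open>s\<close> of outer iteration
  \<open>k\<close>, and \<open>j k\<close> is the index of the inner iterate that is output by outer iteration \<open>k\<close>.\<close>

primrec restart_iter ::
  "'a::euclidean_space set \<Rightarrow> ('a \<Rightarrow> 'b \<Rightarrow> 'a) \<Rightarrow> ('a \<Rightarrow> real) \<Rightarrow> 'a \<Rightarrow>
   (nat \<Rightarrow> nat \<Rightarrow> 'b) \<Rightarrow> (nat \<Rightarrow> nat) \<Rightarrow> nat \<Rightarrow> 'a" where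
  "restart_iter X G \<alpha> x\<^sub>0 z j 0 = x\<^sub>0"
| "restart_iter X G \<alpha> x\<^sub>0 z j (Suc k) =
     proj_subgrad X G (\<alpha> (restart_iter X G \<alpha> x\<^sub>0 z j k)) (restart_iter X G \<alpha> x\<^sub>0 z j k) (z k) (j k)"

definition has_law :: "'w measure \<Rightarrow> ('w \<Rightarrow> 'b) \<Rightarrow> 'b measure \<Rightarrow> bool" where
  "has_law M Y P \<longleftrightarrow> Y \<in> measurable M P \<and> distr M P Y = P"

text \<open>Generating events of the samples (index \<open>Inl (k, s)\<close>) and of the output indices
  (index \<open>Inr k\<close>). The constant \<open>indep_vars\<close> does not apply directly to the joint family,
  since its two kinds of members have different value types.\<close>

definition sampling_events ::
  "'w measure \<Rightarrow> 'b measure \<Rightarrow> (nat \<Rightarrow> nat \<Rightarrow> 'w \<Rightarrow> 'b) \<Rightarrow> (nat \<Rightarrow> 'w \<Rightarrow> nat) \<Rightarrow>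
   (nat \<times> nat) + nat \<Rightarrow> 'w set set" where
  "sampling_events M P \<xi> J i =
     (case i of
        Inl (k, s) \<Rightarrow> {\<xi> k s -` A \<inter> space M | A. A \<in> sets P}
      | Inr k \<Rightarrow> {J k -` A \<inter> space M | A. True})"

text \<open>The randomness used by \<open>N\<close> outer iterations of \<open>t\<close> inner iterations each.\<close>

definition restart_sampling ::
  "'w measure \<Rightarrow> 'b measure \<Rightarrow> nat \<Rightarrow> nat \<Rightarrow> (nat \<Rightarrow> nat \<Rightarrow> 'w \<Rightarrow> 'b) \<Rightarrow> (nat \<Rightarrow> 'w \<Rightarrow> nat) \<Rightarrow> bool" where
  "restart_sampling M P N t \<xi> J \<longleftrightarrow>
     prob_space M \<and>
     (\<forall>k<N. \<forall>s<t. has_law M (\<xi> k s) P) \<and>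
     (\<forall>k<N. has_law M (J k) (uniform_count_measure {0..t})) \<and>
     prob_space.indep_sets M (sampling_events M P \<xi> J)
       (Inl ` ({..<N} \<times> {..<t}) \<union> Inr ` {..<N})"

text \<open>The value at \<open>0\<close> is the one given by the convention \<open>0\<^sup>0 = 1\<close>; in HOL
  \<open>0 powr 0 = 0\<close>.\<close>

definition restart_bound :: "real \<Rightarrow> real \<Rightarrow> real \<Rightarrow> nat \<Rightarrow> real \<Rightarrow> real" where
  "restart_bound \<Delta> C \<theta> T x =
     (if x = 0 then \<Delta>
      else \<Delta> * (C * x / real T) powr ((1 - (4 * \<theta>) powr (- x)) / (4 * \<theta> - 1)))"

definition opt_outer :: "real \<Rightarrow> real \<Rightarrow> real \<Rightarrow> nat \<Rightarrow> real" where
  "opt_outer \<Delta> C \<theta> T = arg_min_on (restart_bound \<Delta> C \<theta> T) {0..}"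

definition asymp_le :: "(nat \<Rightarrow> real) \<Rightarrow> (nat \<Rightarrow> real) \<Rightarrow> bool" where
  "asymp_le a b \<longleftrightarrow> (\<exists>u. u \<sim>[at_top] b \<and> (\<forall>\<^sub>F T in at_top. a T \<le> u T))"

end

theory Submission
  imports Defs "HOL-Real_Asymp.Real_Asymp"
begin

text \<open>The proximal point \<open>prox y\<close> is a competitor in the envelope of the next projected step, so
  nonexpansiveness of the projection, the weak subgradient inequality and strong convexity of the
  proximal objective give the descent inequality
  \<open>E F (y\<^sub>+) + (\<alpha> / 2) |\<nabla>F y|\<^sup>2 \<le> F y + \<alpha>\<^sup>2 \<rho> L\<^sup>2\<close>. Summing it over the inner run and choosing
  \<open>\<alpha>\<close> as in the scheme yields, for \<open>\<Delta>\<^sub>k = F x\<^sub>k - f\<^sup>*\<close>,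
  \<open>E |\<nabla>F x\<^sub>k\<^sub>+\<^sub>1|\<^sup>2 \<le> 4 L sqrt (\<rho> / (t + 1)) E sqrt \<Delta>\<^sub>k\<close>. By the Lojasiewicz inequality the left-hand
  side is at least \<open>c\<^sup>2 E \<Delta>\<^sub>k\<^sub>+\<^sub>1 powr (2 \<theta>)\<close>, and comparing moments gives a recursion for
  \<open>E \<Delta>\<^sub>k powr (2 \<theta>)\<close> whose solution after \<open>N\<close> restarts is exactly the quantity minimized by
  \<open>N\<^sup>*\<close>.

  For the asymptotics, the first-order condition at the minimizer reads
  \<open>(4 \<theta>) powr (- N\<^sup>*) * ln (T / (C N\<^sup>*)) = (1 - (4 \<theta>) powr (- N\<^sup>*)) / (N\<^sup>* ln (4 \<theta>))\<close>.
  Its right-hand side tends to \<open>0\<close>, so the exponent in the bound may be replaced by its limit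
  \<open>1 / (4 \<theta> - 1)\<close>, and this survives rounding \<open>N\<^sup>*\<close> up.\<close>

section \<open>Moreau envelope of a weakly convex function on a convex set\<close>

text \<open>Subtracting the quadratic from the convexity inequality leaves the error term, because
  \<open>(1 - u) * (norm y)\<^sup>2 + u * (norm z)\<^sup>2\<close> exceeds the squared norm of the
  mean by \<open>u * (1 - u) * (norm (z - y))\<^sup>2\<close>.\<close>

lemma weakly_convexD:
  fixes g :: "'a::euclidean_space \<Rightarrow> real"
  assumes "weakly_convex \<rho> g" "0 \<le> u" "u \<le> 1"
  shows "g (y + u *\<^sub>R (z - y)) \<le> (1 - u) * g y + u * g z + \<rho> / 2 * u * (1 - u) * (norm (z - y))\<^sup>2"
proof -
  have e: "y + u *\<^sub>R (z - y) = (1 - u) *\<^sub>R y + u *\<^sub>R z"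
    by (simp add: algebra_simps)
  have "g ((1 - u) *\<^sub>R y + u *\<^sub>R z) + \<rho> / 2 * (norm ((1 - u) *\<^sub>R y + u *\<^sub>R z))\<^sup>2
     \<le> (1 - u) * (g y + \<rho> / 2 * (norm y)\<^sup>2) + u * (g z + \<rho> / 2 * (norm z)\<^sup>2)"
    using assms convex_onD[of UNIV "\<lambda>x. g x + \<rho> / 2 * (norm x)\<^sup>2" u y z]
    unfolding weakly_convex_def by simp
  moreover have "(1 - u) * (norm y)\<^sup>2 + u * (norm z)\<^sup>2 - (norm ((1 - u) *\<^sub>R y + u *\<^sub>R z))\<^sup>2
      = u * (1 - u) * (norm (z - y))\<^sup>2"
    unfolding power2_norm_eq_inner
    by (simp add: inner_diff_left inner_diff_right inner_add_left inner_add_right inner_commute algebra_simps power2_eq_square)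
  then have "\<rho> / 2 * ((1 - u) * (norm y)\<^sup>2 + u * (norm z)\<^sup>2 - (norm ((1 - u) *\<^sub>R y + u *\<^sub>R z))\<^sup>2)
      = \<rho> / 2 * u * (1 - u) * (norm (z - y))\<^sup>2"
    by (simp only: mult.assoc)
  then have "(1 - u) * (\<rho> / 2 * (norm y)\<^sup>2) + u * (\<rho> / 2 * (norm z)\<^sup>2)
      - \<rho> / 2 * (norm ((1 - u) *\<^sub>R y + u *\<^sub>R z))\<^sup>2 = \<rho> / 2 * u * (1 - u) * (norm (z - y))\<^sup>2"
    by (simp only: right_diff_distrib distrib_left mult.left_commute)
  ultimately show ?thesis
    unfolding e distrib_left by linarith
qed

lemma weakly_convex_continuous_on:
  fixes g :: "'a::euclidean_space \<Rightarrow> real"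
  assumes "weakly_convex \<rho> g"
  shows "continuous_on S g"
proof -
  have "continuous_on UNIV (\<lambda>x. g x + \<rho> / 2 * (norm x)\<^sup>2)"
    using assms unfolding weakly_convex_def by (intro convex_on_continuous) auto
  then have "continuous_on UNIV (\<lambda>x. (g x + \<rho> / 2 * (norm x)\<^sup>2) - \<rho> / 2 * (norm x)\<^sup>2)"
    by (rule continuous_on_diff) (intro continuous_intros)
  then show ?thesis
    by (simp add: continuous_on_subset[OF _ subset_UNIV])
qed

text \<open>The local inequality becomes global: near \<open>y\<close> on the segment towards
  \<open>z\<close>, the subgradient bounds \<open>g\<close> from below up to
  \<open>\<epsilon> * u * norm d\<close>, weak convexity bounds it from above, and dividing by
  \<open>u\<close> leaves arbitrarily small errors.\<close>

lemma frechet_subdiff_weakly_convexD: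
  fixes g :: "'a::euclidean_space \<Rightarrow> real"
  assumes g: "weakly_convex \<rho> g" and v: "v \<in> frechet_subdiff g y"
  shows "g y + v \<bullet> (z - y) - \<rho> / 2 * (norm (z - y))\<^sup>2 \<le> g z"
proof (cases "z = y")
  case False
  define d where "d = z - y"
  have d: "norm d > 0" using False by (simp add: d_def)
  have line: "eventually (\<lambda>u::real. 0 < u \<and> u < 1 \<and>
      g y + u * (v \<bullet> d) - \<epsilon> * u * norm d \<le> g (y + u *\<^sub>R d)) (at_right 0)" if "\<epsilon> > 0" for \<epsilon> :: real
  proof -
    have "0 \<le> Liminf (at y) (\<lambda>w. ereal ((g w - g y - v \<bullet> (w - y)) / norm (w - y)))"
      using v by (simp add: frechet_subdiff_def)
    then have "ereal (- \<epsilon>) < Liminf (at y) (\<lambda>w. ereal ((g w - g y - v \<bullet> (w - y)) / norm (w - y)))"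
      using that by (rule_tac less_le_trans[of _ 0]) (simp_all add: zero_ereal_def)
    then have ev: "eventually (\<lambda>w. ereal (- \<epsilon>) < ereal ((g w - g y - v \<bullet> (w - y)) / norm (w - y))) (at y)"
      using less_LiminfD by blast
    have lim: "filterlim (\<lambda>u::real. y + u *\<^sub>R d) (at y) (at_right 0)"
    proof (rule filterlim_atI)
      have "((\<lambda>u::real. y + u *\<^sub>R d) \<longlongrightarrow> y + 0 *\<^sub>R d) (at_right 0)"
        by (intro tendsto_intros)
      then show "((\<lambda>u::real. y + u *\<^sub>R d) \<longlongrightarrow> y) (at_right 0)" by simp
      show "\<forall>\<^sub>F u in at_right 0. y + u *\<^sub>R d \<noteq> y"
        using d by (auto simp: eventually_at_filter)
    qed
    have "\<forall>\<^sub>F u::real in at_right 0. 0 < u \<and> u < 1"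
      by (auto simp: eventually_at_right[of 0 1] intro!: exI[of _ 1])
    then show ?thesis
      using filterlim_iff[THEN iffD1, OF lim, rule_format, OF ev]
    proof eventually_elim
      case (elim u)
      then have "- \<epsilon> < (g (y + u *\<^sub>R d) - g y - u * (v \<bullet> d)) / (u * norm d)"
        by simp
      then have "- \<epsilon> * (u * norm d) < g (y + u *\<^sub>R d) - g y - u * (v \<bullet> d)"
        using elim d by (simp add: pos_less_divide_eq mult_pos_pos)
      then show ?case using elim by (simp add: algebra_simps)
    qed
  qed
  have "v \<bullet> d - \<rho> / 2 * (norm d)\<^sup>2 - (g z - g y) \<le> e" if "e > 0" for e :: real
  proof -
    \<comment> \<open>This choice makes the two errors, \<open>\<epsilon> * norm d\<close> from the
      lower limit and \<open>\<bar>\<rho> / 2\<bar> * \<epsilon> * (norm d)\<^sup>2\<close> from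
      \<open>u < \<epsilon>\<close>, add up to exactly \<open>e\<close>. The absolute value is taken
      because the sign of \<open>\<rho>\<close> is not fixed here.\<close>
    define \<epsilon> where "\<epsilon> = e / (norm d + \<bar>\<rho> / 2\<bar> * (norm d)\<^sup>2)"
    have pos: "norm d + \<bar>\<rho> / 2\<bar> * (norm d)\<^sup>2 > 0" using d by (simp add: add_pos_nonneg)
    have "\<epsilon> * (norm d + \<bar>\<rho> / 2\<bar> * (norm d)\<^sup>2) = e"
      unfolding \<epsilon>_def by (rule nonzero_eq_divide_eq[THEN iffD1, OF _ refl]) (use pos in linarith)
    then have \<epsilon>2: "\<epsilon> * norm d + \<bar>\<rho> / 2\<bar> * \<epsilon> * (norm d)\<^sup>2 = e"
      by (simp only: distrib_left mult.assoc mult.left_commute)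
    have \<epsilon>1: "\<epsilon> > 0"
      unfolding \<epsilon>_def by (rule divide_pos_pos[OF that pos])
    have "\<forall>\<^sub>F u::real in at_right 0. u < \<epsilon>"
      using \<epsilon>1 by (auto simp: eventually_at_right[of 0 1] intro!: exI[of _ \<epsilon>])
    with line[OF \<epsilon>1]
    have "\<forall>\<^sub>F u::real in at_right 0. u < \<epsilon> \<and> 0 < u \<and> u < 1 \<and>
      g y + u * (v \<bullet> d) - \<epsilon> * u * norm d \<le> g (y + u *\<^sub>R d)"
      by eventually_elim auto
    from eventually_happens'[OF trivial_limit_at_right_real this]
    obtain u where u: "u < \<epsilon>" "0 < u" "u < 1"
      "g y + u * (v \<bullet> d) - \<epsilon> * u * norm d \<le> g (y + u *\<^sub>R d)"
      by blast
    have "g (y + u *\<^sub>R d) \<le> (1 - u) * g y + u * g z + \<rho> / 2 * u * (1 - u) * (norm d)\<^sup>2"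
      using weakly_convexD[OF g, of u y z] u by (simp add: d_def)
    with u(4) have "u * (v \<bullet> d - \<epsilon> * norm d) \<le> u * (g z - g y + \<rho> / 2 * (1 - u) * (norm d)\<^sup>2)"
      by (simp add: algebra_simps)
    then have "v \<bullet> d - \<epsilon> * norm d \<le> g z - g y + \<rho> / 2 * (1 - u) * (norm d)\<^sup>2"
      using u(2) by simp
    moreover have "- (\<rho> / 2) * u * (norm d)\<^sup>2 \<le> \<bar>\<rho> / 2\<bar> * \<epsilon> * (norm d)\<^sup>2"
      using u by (intro mult_right_mono mult_mono) auto
    moreover have "\<rho> / 2 * (1 - u) * (norm d)\<^sup>2 = \<rho> / 2 * (norm d)\<^sup>2 + - (\<rho> / 2) * u * (norm d)\<^sup>2"
      by (simp add: algebra_simps diff_divide_distrib)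
    ultimately show ?thesis using \<epsilon>2 by linarith
  qed
  then have "v \<bullet> d - \<rho> / 2 * (norm d)\<^sup>2 - (g z - g y) \<le> 0"
    by (rule_tac field_le_epsilon) simp
  then show ?thesis by (simp add: d_def)
qed simp

section \<open>Gradients identified by expansions with quadratic error\<close>

lemma gradient_eqI:
  assumes "GDERIV F x :> D"
  shows "gradient F x = D"
  unfolding gradient_def
proof (rule the_equality)
  fix D' assume "GDERIV F x :> D'"
  then have "(\<lambda>h. h \<bullet> D') = (\<lambda>h. h \<bullet> D)"
    using assms unfolding gderiv_def by (rule has_derivative_unique)
  then have "(D' - D) \<bullet> D' = (D' - D) \<bullet> D" by metis
  then have "(D' - D) \<bullet> (D' - D) = 0" by (simp add: inner_diff_right)
  then show "D' = D" by simp
qed fact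

lemma GDERIV_quadraticI:
  fixes F :: "'a::real_inner \<Rightarrow> real"
  assumes "\<And>y. \<bar>F y - F x - D \<bullet> (y - x)\<bar> \<le> K * (norm (y - x))\<^sup>2"
  shows "GDERIV F x :> D"
  unfolding gderiv_def has_derivative_at
proof
  show "bounded_linear (\<lambda>h. h \<bullet> D)" by (rule bounded_linear_inner_left)
  show "(\<lambda>h. norm (F (x + h) - F x - h \<bullet> D) / norm h) \<midarrow>0\<rightarrow> 0"
  proof (rule Lim_null_comparison)
    have "((\<lambda>h::'a. K * norm h) \<longlongrightarrow> K * norm (0::'a)) (at 0)" by (intro tendsto_intros)
    then show "((\<lambda>h::'a. K * norm h) \<longlongrightarrow> 0) (at 0)" by simp
    have "norm (norm (F (x + h) - F x - h \<bullet> D) / norm h) \<le> K * norm h" if "h \<noteq> 0" for h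
      using assms[of "x + h"] that by (simp add: inner_commute divide_le_eq power2_eq_square mult.assoc)
    then show "\<forall>\<^sub>F h in at 0. norm (norm (F (x + h) - F x - h \<bullet> D) / norm h) \<le> K * norm h"
      by (simp add: eventually_at_filter)
  qed
qed

section \<open>Proximal map and Moreau envelope at parameter \<open>1 / (2 * \<rho>)\<close>\<close>

locale weakly_convex_constrained =
  fixes g :: "'a::euclidean_space \<Rightarrow> real" and X :: "'a set" and \<rho> fstar :: real
  assumes rho: "\<rho> > 0"
    and g: "weakly_convex \<rho> g"
    and X: "X \<noteq> {}" "closed X" "convex X"
    and lower: "\<And>y. y \<in> X \<Longrightarrow> fstar \<le> g y"
begin

text \<open>The weight \<open>\<rho>\<close> is \<open>1 / (2 * lam)\<close> at
  \<open>lam = 1 / (2 * \<rho>)\<close>. The indicator of \<open>X\<close> is expressed by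
  restricting competitors to \<open>X\<close>.\<close>

definition obj :: "'a \<Rightarrow> 'a \<Rightarrow> real" where
  "obj x y = g y + \<rho> * (norm (y - x))\<^sup>2"

text \<open>A minimizer to choose exists by \<open>obj_minimizer_exists\<close>, and
  \<open>obj_strongly_convex\<close> makes it unique.\<close>

definition prox :: "'a \<Rightarrow> 'a" where
  "prox x = (SOME p. p \<in> X \<and> (\<forall>z\<in>X. obj x p \<le> obj x z))"

definition env :: "'a \<Rightarrow> real" where
  "env x = obj x (prox x)"

text \<open>Coercivity: off a ball around \<open>x\<close> the lower bound \<open>fstar\<close> plus
  the quadratic term already reaches the value at a competitor \<open>w\<close>, and on the compact
  remainder the continuous objective attains its minimum.\<close>

lemma obj_minimizer_exists: "\<exists>p. p \<in> X \<and> (\<forall>z\<in>X. obj x p \<le> obj x z)"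
proof -
  obtain w where w: "w \<in> X" using X(1) by blast
  \<comment> \<open>The radius at which \<open>fstar + \<rho> * r\<^sup>2\<close> equals
    \<open>obj x w\<close>.\<close>
  define r where "r = sqrt ((obj x w - fstar) / \<rho>)"
  have r0: "0 \<le> (obj x w - fstar) / \<rho>"
    using lower[OF w] rho by (auto simp: obj_def intro!: divide_nonneg_pos add_increasing2)
  define K where "K = X \<inter> cball x r"
  have outside: "obj x w \<le> obj x z" if "z \<in> X" "z \<notin> cball x r" for z
  proof -
    have "r < norm (z - x)" using that(2) by (simp add: dist_norm norm_minus_commute)
    then have "r\<^sup>2 \<le> (norm (z - x))\<^sup>2" using r0 by (intro power_mono) (auto simp: r_def)
    then have "\<rho> * r\<^sup>2 \<le> \<rho> * (norm (z - x))\<^sup>2" using rho by simp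
    moreover have "\<rho> * r\<^sup>2 = obj x w - fstar" using rho r0 by (simp add: r_def)
    ultimately show ?thesis using lower[OF that(1)] by (simp add: obj_def)
  qed
  show ?thesis
  proof (cases "K = {}")
    case True
    then show ?thesis using outside w unfolding K_def by blast
  next
    case False
    have "compact K" unfolding K_def using X(2) by (simp add: closed_Int_compact)
    moreover have "continuous_on K (obj x)"
      unfolding obj_def[abs_def]
      by (intro continuous_intros weakly_convex_continuous_on[OF g])
    ultimately obtain p where p: "p \<in> K" "\<And>z. z \<in> K \<Longrightarrow> obj x p \<le> obj x z"
      using False continuous_attains_inf[of K "obj x"] by blast
    show ?thesis
    proof (cases "obj x p \<le> obj x w")
      case True
      then show ?thesis using p outside unfolding K_def by force
    next
      case False
      then have "w \<notin> K" using p by blast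
      then show ?thesis using p outside w False unfolding K_def by force
    qed
  qed
qed

lemma prox_in: "prox x \<in> X" and obj_prox_le: "z \<in> X \<Longrightarrow> obj x (prox x) \<le> obj x z"
  using someI_ex[OF obj_minimizer_exists[of x]] unfolding prox_def by blast+

text \<open>The penalty has twice the convexity that \<open>g\<close> lacks, so \<open>obj x\<close>
  keeps half of it and grows quadratically off its minimizer. Minimality is tested at points of the
  segment towards \<open>z\<close>, the inequality is divided by \<open>u\<close>, and
  \<open>u\<close> tends to \<open>0\<close>.\<close>

lemma obj_strongly_convex:
  assumes z: "z \<in> X"
  shows "env x + \<rho> / 2 * (norm (z - prox x))\<^sup>2 \<le> obj x z"
proof -
  define p where "p = prox x"
  have step: "\<rho> / 2 * (1 - u) * (norm (z - p))\<^sup>2 \<le> obj x z - obj x p" if u: "0 < u" "u < 1" for u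
  proof -
    have "p + u *\<^sub>R (z - p) = (1 - u) *\<^sub>R p + u *\<^sub>R z" by (simp add: algebra_simps)
    then have "p + u *\<^sub>R (z - p) \<in> X"
      using X(3) prox_in z u by (auto simp: p_def convex_def)
    then have 1: "obj x p \<le> obj x (p + u *\<^sub>R (z - p))"
      unfolding p_def by (rule obj_prox_le)
    have 2: "g (p + u *\<^sub>R (z - p)) \<le> (1 - u) * g p + u * g z + \<rho> / 2 * u * (1 - u) * (norm (z - p))\<^sup>2"
      using weakly_convexD[OF g] u by simp
    have "(norm (p + u *\<^sub>R (z - p) - x))\<^sup>2
       = (1 - u) * (norm (p - x))\<^sup>2 + u * (norm (z - x))\<^sup>2 - u * (1 - u) * (norm (z - p))\<^sup>2"
      unfolding power2_norm_eq_inner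
      by (simp add: inner_diff_left inner_diff_right inner_add_left inner_add_right inner_commute algebra_simps power2_eq_square)
    then have "obj x (p + u *\<^sub>R (z - p)) = g (p + u *\<^sub>R (z - p)) +
        \<rho> * ((1 - u) * (norm (p - x))\<^sup>2 + u * (norm (z - x))\<^sup>2 - u * (1 - u) * (norm (z - p))\<^sup>2)"
      by (simp add: obj_def)
    with 1 2 have 3: "obj x p \<le> (1 - u) * g p + u * g z + \<rho> / 2 * u * (1 - u) * (norm (z - p))\<^sup>2 +
        \<rho> * ((1 - u) * (norm (p - x))\<^sup>2 + u * (norm (z - x))\<^sup>2 - u * (1 - u) * (norm (z - p))\<^sup>2)"
      by linarith
    have "\<dots> = obj x p + u * (obj x z - obj x p) - u * (\<rho> / 2 * (1 - u) * (norm (z - p))\<^sup>2)"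
      unfolding obj_def by (simp add: field_simps)
    with 3 have "u * (\<rho> / 2 * (1 - u) * (norm (z - p))\<^sup>2) \<le> u * (obj x z - obj x p)"
      by linarith
    then show ?thesis using u by simp
  qed
  have "((\<lambda>u. \<rho> / 2 * (1 - u) * (norm (z - p))\<^sup>2) \<longlongrightarrow> \<rho> / 2 * (1 - 0) * (norm (z - p))\<^sup>2) (at_right 0)"
    by (intro tendsto_intros)
  moreover have "\<forall>\<^sub>F u::real in at_right 0. \<rho> / 2 * (1 - u) * (norm (z - p))\<^sup>2 \<le> obj x z - obj x p"
    using step by (auto simp: eventually_at_right[of 0 1] intro!: exI[of _ 1])
  ultimately have "\<rho> / 2 * (1 - 0) * (norm (z - p))\<^sup>2 \<le> obj x z - obj x p"
    by (intro tendsto_upperbound) auto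
  then show ?thesis by (simp add: env_def p_def)
qed

lemma env_le: "z \<in> X \<Longrightarrow> env x \<le> obj x z"
  using obj_prox_le by (simp add: env_def)

text \<open>Adding the growth inequalities at \<open>x\<close> and at \<open>y\<close>, each tested
  at the other proximal point, cancels \<open>g\<close> and leaves an inner product for
  Cauchy-Schwarz.\<close>

lemma norm_prox_diff_le: "norm (prox x - prox y) \<le> 2 * norm (x - y)"
proof -
  let ?p = "prox x" and ?q = "prox y"
  have "env x + \<rho> / 2 * (norm (?q - ?p))\<^sup>2 \<le> obj x ?q" "env y + \<rho> / 2 * (norm (?p - ?q))\<^sup>2 \<le> obj y ?p"
    using obj_strongly_convex prox_in by blast+
  then have "\<rho> * (norm (?p - ?q))\<^sup>2
      \<le> \<rho> * ((norm (?q - x))\<^sup>2 + (norm (?p - y))\<^sup>2 - (norm (?p - x))\<^sup>2 - (norm (?q - y))\<^sup>2)"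
    unfolding env_def obj_def by (simp add: norm_minus_commute[of ?q ?p] algebra_simps)
  then have "(norm (?p - ?q))\<^sup>2
      \<le> (norm (?q - x))\<^sup>2 + (norm (?p - y))\<^sup>2 - (norm (?p - x))\<^sup>2 - (norm (?q - y))\<^sup>2"
    using rho by simp
  also have "\<dots> = 2 * ((?p - ?q) \<bullet> (x - y))"
    unfolding power2_norm_eq_inner
    by (simp add: inner_diff_left inner_diff_right inner_commute algebra_simps)
  also have "\<dots> \<le> 2 * (norm (?p - ?q) * norm (x - y))"
    using norm_cauchy_schwarz[of "?p - ?q" "x - y"] by simp
  finally have "norm (?p - ?q) * norm (?p - ?q) \<le> norm (?p - ?q) * (2 * norm (x - y))"
    by (simp add: power2_eq_square algebra_simps)
  then show ?thesis
    by (cases "norm (?p - ?q) = 0") (auto simp: mult_le_cancel_left)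
qed

lemma env_upper: "env y \<le> env x + 2 * \<rho> * ((x - prox x) \<bullet> (y - x)) + \<rho> * (norm (y - x))\<^sup>2"
proof -
  have "env y \<le> obj y (prox x)" by (rule env_le[OF prox_in])
  also have "\<dots> = env x + \<rho> * ((norm (prox x - y))\<^sup>2 - (norm (prox x - x))\<^sup>2)"
    by (simp add: env_def obj_def algebra_simps)
  also have "(norm (prox x - y))\<^sup>2 - (norm (prox x - x))\<^sup>2 = 2 * ((x - prox x) \<bullet> (y - x)) + (norm (y - x))\<^sup>2"
    unfolding power2_norm_eq_inner
    by (simp add: inner_diff_left inner_diff_right inner_commute algebra_simps)
  finally show ?thesis by (simp add: algebra_simps)
qed

text \<open>One side is \<open>env_upper\<close>, where \<open>prox x\<close> competes at
  \<open>y\<close>. The other is \<open>env_upper\<close> with the points exchanged,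
  \<open>prox y\<close> being traded for \<open>prox x\<close> through the Lipschitz bound.\<close>

lemma GDERIV_env: "GDERIV env x :> (2 * \<rho>) *\<^sub>R (x - prox x)"
\<comment> \<open>The two sides need the constants \<open>\<rho>\<close> and
  \<open>3 * \<rho>\<close>; anything larger serves as well.\<close>
proof (rule GDERIV_quadraticI[where K = "7 * \<rho>"])
  fix y
  let ?d = "y - x"
  have 1: "env y - env x - 2 * \<rho> * ((x - prox x) \<bullet> ?d) \<le> \<rho> * (norm ?d)\<^sup>2"
    using env_upper[of y x] by simp
  have "((prox y - prox x) \<bullet> ?d) \<le> norm (prox y - prox x) * norm ?d"
    by (rule norm_cauchy_schwarz)
  also have "\<dots> \<le> (2 * norm ?d) * norm ?d"
    by (intro mult_right_mono norm_prox_diff_le) auto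
  finally have "2 * \<rho> * ((prox y - prox x) \<bullet> ?d) \<le> 2 * \<rho> * (2 * (norm ?d)\<^sup>2)"
    using rho by (simp add: power2_eq_square)
  moreover have "env x - env y - 2 * \<rho> * ((y - prox y) \<bullet> (x - y)) \<le> \<rho> * (norm ?d)\<^sup>2"
    using env_upper[of x y] by (simp add: norm_minus_commute)
  moreover have "(y - prox y) \<bullet> (x - y) = - ((x - prox x) \<bullet> ?d) - (norm ?d)\<^sup>2 + ((prox y - prox x) \<bullet> ?d)"
    unfolding power2_norm_eq_inner
    by (simp add: inner_diff_left inner_diff_right inner_commute algebra_simps)
  then have "2 * \<rho> * ((y - prox y) \<bullet> (x - y)) = - (2 * \<rho> * ((x - prox x) \<bullet> ?d))
      - 2 * \<rho> * (norm ?d)\<^sup>2 + 2 * \<rho> * ((prox y - prox x) \<bullet> ?d)"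
    by (simp only: distrib_left right_diff_distrib mult_minus_right)
  ultimately have "2 * \<rho> * ((x - prox x) \<bullet> ?d) - (env y - env x) \<le> 3 * (\<rho> * (norm ?d)\<^sup>2)"
    by linarith
  moreover have "0 \<le> \<rho> * (norm ?d)\<^sup>2" using rho by simp
  ultimately have "\<bar>env y - env x - 2 * \<rho> * ((x - prox x) \<bullet> ?d)\<bar> \<le> 7 * (\<rho> * (norm ?d)\<^sup>2)"
    using 1 by (intro abs_leI) linarith+
  then show "\<bar>env y - env x - (2 * \<rho>) *\<^sub>R (x - prox x) \<bullet> ?d\<bar> \<le> 7 * \<rho> * (norm ?d)\<^sup>2"
    by (simp add: mult.assoc)
qed

lemma gradient_env: "gradient env x = (2 * \<rho>) *\<^sub>R (x - prox x)"
  by (rule gradient_eqI[OF GDERIV_env])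

lemma norm_gradient_env_power2: "(norm (gradient env x))\<^sup>2 = 4 * \<rho>\<^sup>2 * (norm (x - prox x))\<^sup>2"
  by (simp add: gradient_env power_mult_distrib)

lemma continuous_on_prox: "continuous_on S prox"
proof (rule lipschitz_on_continuous_on[of 2], rule lipschitz_onI)
  show "dist (prox x) (prox y) \<le> 2 * dist x y" for x y
    using norm_prox_diff_le by (simp add: dist_norm)
qed simp

lemma continuous_on_env: "continuous_on S env"
  unfolding env_def[abs_def] obj_def[abs_def]
  by (intro continuous_intros continuous_on_prox
      continuous_on_compose2[OF weakly_convex_continuous_on[OF g, of UNIV]]) auto

lemma continuous_on_gradient_env: "continuous_on S (gradient env)"
  unfolding gradient_env[abs_def] by (intro continuous_intros continuous_on_prox)

text \<open>The envelope is \<open>g (prox x)\<close>, at least \<open>fstar\<close>, plus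
  \<open>\<rho>\<close> times the squared displacement, and the gradient is
  \<open>2 * \<rho>\<close> times the displacement. In particular the gradient vanishes where the
  gap does.\<close>

lemma gradient_env_le: "(norm (gradient env x))\<^sup>2 \<le> 4 * \<rho> * (env x - fstar)"
proof -
  have "\<rho> * (norm (x - prox x))\<^sup>2 \<le> env x - fstar"
    using lower[OF prox_in, of x] by (simp add: env_def obj_def norm_minus_commute)
  then have "4 * \<rho> * (\<rho> * (norm (x - prox x))\<^sup>2) \<le> 4 * \<rho> * (env x - fstar)"
    using rho by simp
  then show ?thesis
    unfolding norm_gradient_env_power2 power2_eq_square[of \<rho>] by (simp only: mult.assoc)
qed

lemma env_ge: "fstar \<le> env x"
proof -
  have "0 \<le> 4 * \<rho> * (env x - fstar)"
    using gradient_env_le[of x] by (rule order_trans[OF zero_le_power2])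
  then show ?thesis using rho by (simp add: zero_le_mult_iff)
qed

text \<open>The infimum is attained at \<open>prox x\<close> with a finite value, so converting it
  to a real number is faithful.\<close>

lemma moreau_env_eq:
  "moreau_env (1 / (2 * \<rho>)) (\<lambda>y. ereal (g y) + convex_indicator X y) = env"
proof
  fix x
  have "(INF y. (ereal (g y) + convex_indicator X y) + ereal (1 / (2 * (1 / (2 * \<rho>))) * (norm (y - x))\<^sup>2))
      = ereal (env x)"
  proof (rule antisym)
    show "ereal (env x) \<le> (INF y. (ereal (g y) + convex_indicator X y) + ereal (1 / (2 * (1 / (2 * \<rho>))) * (norm (y - x))\<^sup>2))"
      using env_le rho by (intro INF_greatest) (auto simp: convex_indicator_def obj_def)
    show "(INF y. (ereal (g y) + convex_indicator X y) + ereal (1 / (2 * (1 / (2 * \<rho>))) * (norm (y - x))\<^sup>2)) \<le> ereal (env x)"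
      using prox_in[of x] by (intro INF_lower2[of "prox x"]) (auto simp: convex_indicator_def obj_def env_def)
  qed
  then show "moreau_env (1 / (2 * \<rho>)) (\<lambda>y. ereal (g y) + convex_indicator X y) x = env x"
    by (simp add: moreau_env_def)
qed

section \<open>A projected step measured by the envelope\<close>

text \<open>With \<open>d = norm (y - prox y)\<close>, the growth inequality tested at
  \<open>y\<close> gives \<open>g y - g (prox y) \<ge> 3 / 2 * \<rho> * d\<^sup>2\<close>, of which
  the weak subgradient inequality gives back \<open>\<rho> / 2 * d\<^sup>2\<close>.\<close>

lemma inner_subgradient_prox_le:
  assumes y: "y \<in> X" and v: "v \<in> frechet_subdiff g y"
  shows "v \<bullet> (prox y - y) \<le> - \<rho> * (norm (y - prox y))\<^sup>2"
proof -
  have "g y + v \<bullet> (prox y - y) - \<rho> / 2 * (norm (prox y - y))\<^sup>2 \<le> g (prox y)"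
    by (rule frechet_subdiff_weakly_convexD[OF g v])
  moreover have "env y + \<rho> / 2 * (norm (y - prox y))\<^sup>2 \<le> obj y y"
    by (rule obj_strongly_convex[OF y])
  ultimately show ?thesis
    by (simp add: env_def obj_def norm_minus_commute[of y])
qed

text \<open>\<open>prox y\<close> lies in \<open>X\<close>, so the nonexpansive projection fixes it
  and moves the step no farther from it. It is then used as a competitor in the envelope at the new
  point.\<close>

lemma env_projected_step_le:
  assumes "y \<in> X"
  shows "env (closest_point X (y - \<alpha> *\<^sub>R w))
    \<le> env y + 2 * \<rho> * \<alpha> * (w \<bullet> (prox y - y)) + \<rho> * \<alpha>\<^sup>2 * (norm w)\<^sup>2"
proof -
  let ?u = "y - \<alpha> *\<^sub>R w"
  have "env (closest_point X ?u) \<le> obj (closest_point X ?u) (prox y)"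
    by (rule env_le[OF prox_in])
  also have "\<dots> \<le> g (prox y) + \<rho> * (norm (prox y - ?u))\<^sup>2"
  proof -
    have "dist (closest_point X (prox y)) (closest_point X ?u) \<le> dist (prox y) ?u"
      by (rule closest_point_lipschitz[OF X(3) X(2) X(1)])
    then have "norm (prox y - closest_point X ?u) \<le> norm (prox y - ?u)"
      using closest_point_self[OF prox_in] by (simp add: dist_norm)
    then have "(norm (prox y - closest_point X ?u))\<^sup>2 \<le> (norm (prox y - ?u))\<^sup>2"
      by (intro power_mono) auto
    then show ?thesis using rho by (simp add: obj_def)
  qed
  also have "(norm (prox y - ?u))\<^sup>2
      = (norm (prox y - y))\<^sup>2 + 2 * \<alpha> * (w \<bullet> (prox y - y)) + \<alpha>\<^sup>2 * (norm w)\<^sup>2"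
    unfolding power2_norm_eq_inner
    by (simp add: inner_diff_left inner_diff_right inner_add_left inner_add_right inner_commute algebra_simps power2_eq_square)
  finally show ?thesis by (simp add: env_def obj_def algebra_simps)
qed

end

section \<open>Projected stochastic subgradient steps\<close>

text \<open>Integrating this tangent-line form of Young's inequality gives the moment comparison
  (Jensen for \<open>u \<mapsto> u powr r\<close>) without knowing in advance that \<open>u\<close> is integrable.\<close>

lemma powr_le_tangent:
  fixes u m r :: real
  assumes "0 \<le> u" "0 < m" "0 < r" "r \<le> 1"
  shows "m powr (1 - r) * u powr r \<le> r * u + (1 - r) * m"
proof (cases "u = 0")
  case False
  then show ?thesis
    using Youngs_inequality_0[of r "1 - r" u m] assms by (simp add: mult.commute)
qed (use assms in simp)

lemma (in prob_space) nn_integral_powr_le: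
  assumes [measurable]: "u \<in> borel_measurable M" and u: "\<And>\<omega>. 0 \<le> u \<omega>"
    and r: "0 < r" "r \<le> 1" and m: "0 < m" "(\<integral>\<^sup>+\<omega>. ennreal (u \<omega>) \<partial>M) \<le> ennreal m"
  shows "(\<integral>\<^sup>+\<omega>. ennreal (u \<omega> powr r) \<partial>M) \<le> ennreal (m powr r)"
proof -
  \<comment> \<open>The tangent is taken at \<open>m\<close>, so its integral is at most
    \<open>r * m + (1 - r) * m = m\<close>, which factors as \<open>c * m powr r\<close>.\<close>
  define c where "c = m powr (1 - r)"
  have c: "c > 0" using m by (simp add: c_def)
  have "ennreal c * (\<integral>\<^sup>+\<omega>. ennreal (u \<omega> powr r) \<partial>M) = (\<integral>\<^sup>+\<omega>. ennreal (c * u \<omega> powr r) \<partial>M)"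
    using c by (subst nn_integral_cmult[symmetric]) (auto simp: ennreal_mult)
  also have "\<dots> \<le> (\<integral>\<^sup>+\<omega>. ennreal r * ennreal (u \<omega>) + ennreal ((1 - r) * m) \<partial>M)"
    using powr_le_tangent[OF u m(1) r] r m(1) u
    by (intro nn_integral_mono)
      (auto simp: c_def ennreal_mult[symmetric] ennreal_plus[symmetric] simp del: ennreal_plus intro!: ennreal_leI)
  also have "\<dots> = ennreal r * (\<integral>\<^sup>+\<omega>. ennreal (u \<omega>) \<partial>M) + ennreal ((1 - r) * m)"
    by (subst nn_integral_add) (auto simp: nn_integral_cmult emeasure_space_1)
  also have "\<dots> \<le> ennreal r * ennreal m + ennreal ((1 - r) * m)"
    by (intro add_right_mono mult_left_mono m) auto
  also have "\<dots> = ennreal m"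
    using r m by (simp add: ennreal_mult[symmetric] ennreal_plus[symmetric] algebra_simps del: ennreal_plus)
  also have "\<dots> = ennreal c * ennreal (m powr r)"
    using m c by (simp add: ennreal_mult[symmetric] c_def powr_add[symmetric])
  finally show ?thesis
    using c by (subst (asm) ennreal_mult_le_mult_iff) auto
qed

section \<open>Independence of disjoint blocks of samples\<close>

text \<open>The generated sigma-algebra is packaged as a measure so that adaptedness can be stated
  with \<open>measurable\<close>.\<close>

definition history :: "'w measure \<Rightarrow> ('i \<Rightarrow> 'w set set) \<Rightarrow> 'i set \<Rightarrow> 'w measure" where
  "history M E I = sigma (space M) (\<Union>i\<in>I. E i)"

lemma space_history [simp]: "space (history M E I) = space M"
  by (simp add: history_def space_measure_of_conv)

lemma sets_history:
  assumes "\<And>i. i \<in> I \<Longrightarrow> E i \<subseteq> Pow (space M)"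
  shows "sets (history M E I) = sigma_sets (space M) (\<Union>i\<in>I. E i)"
  using assms unfolding history_def by (intro sets_measure_of) auto

text \<open>Stated for generating events rather than via \<open>indep_var\<close>, because \<open>Y\<close> and \<open>Z\<close> may have
  different value types.\<close>

lemma (in prob_space) nn_integral_indep_histories:
  assumes indep: "indep_sets E I" and stable: "\<And>i. i \<in> I \<Longrightarrow> Int_stable (E i)"
    and I: "I1 \<subseteq> I" "I2 \<subseteq> I" "I1 \<inter> I2 = {}"
    and Y: "Y \<in> measurable (history M E I1) S" and Z: "Z \<in> measurable (history M E I2) R"
    and h[measurable]: "(\<lambda>(y, z). h y z) \<in> borel_measurable (S \<Otimes>\<^sub>M R)"
  shows "(\<integral>\<^sup>+\<omega>. h (Y \<omega>) (Z \<omega>) \<partial>M) = (\<integral>\<^sup>+\<omega>. (\<integral>\<^sup>+z. h (Y \<omega>) z \<partial>distr M R Z) \<partial>M)"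
proof -
  have sub: "E i \<subseteq> sets M" if "i \<in> I" for i
    using indep that by (auto simp: indep_sets_def)
  have pow: "E i \<subseteq> Pow (space M)" if "i \<in> I" for i
    using sub[OF that] sets.space_closed by auto
  have sets: "sets (history M E K) = sigma_sets (space M) (\<Union>i\<in>K. E i)" if "K \<subseteq> I" for K
    using pow that by (intro sets_history) auto
  have sub': "sets (history M E K) \<subseteq> sets M" if "K \<subseteq> I" for K
    unfolding sets[OF that] using sub that by (intro sets.sigma_sets_subset) auto
  have [measurable]: "Y \<in> measurable M S" "Z \<in> measurable M R"
    using measurable_mono[OF order_refl refl sub'[OF I(1)], of S] Y
      measurable_mono[OF order_refl refl sub'[OF I(2)], of R] Z by auto
  \<comment> \<open>Generators are collected over the disjoint blocks \<open>I1\<close> and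
    \<open>I2\<close>; stability under intersection carries independence over to the generated
    sigma-algebras.\<close>
  have "indep_sets (\<lambda>b. sigma_sets (space M) (\<Union>i\<in>case_bool I1 I2 b. E i)) UNIV"
  proof (rule indep_sets_collect_sigma)
    show "indep_sets E (\<Union>b. case_bool I1 I2 b)"
      by (rule indep_sets_mono_index[OF _ indep]) (use I in \<open>auto split: bool.splits\<close>)
    show "disjoint_family (case_bool I1 I2)"
      using I(3) by (auto simp: disjoint_family_on_def split: bool.splits)
    show "Int_stable (E i)" if "i \<in> case_bool I1 I2 b" for i b
      using that I by (intro stable) (auto split: bool.splits)
  qed
  then have indep': "indep_set (sets (history M E I1)) (sets (history M E I2))"
    unfolding indep_set_def sets[OF I(1)] sets[OF I(2)]
    by (rule indep_sets_mono_sets) (auto split: bool.splits)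
  interpret Y: prob_space "distr M S Y" by (rule prob_space_distr) simp
  interpret Z: prob_space "distr M R Z" by (rule prob_space_distr) simp
  \<comment> \<open>Independence on rectangles identifies the joint law as a product, after which
    Tonelli's theorem integrates \<open>Z\<close> out first.\<close>
  have eq: "distr M S Y \<Otimes>\<^sub>M distr M R Z = distr M (S \<Otimes>\<^sub>M R) (\<lambda>\<omega>. (Y \<omega>, Z \<omega>))"
  proof (rule pair_measure_eqI)
    fix A B assume "A \<in> sets (distr M S Y)" "B \<in> sets (distr M R Z)"
    then have [measurable]: "A \<in> sets S" "B \<in> sets R" by auto
    have "prob ((Y -` A \<inter> space M) \<inter> (Z -` B \<inter> space M)) = prob (Y -` A \<inter> space M) * prob (Z -` B \<inter> space M)"
      using measurable_sets[OF Y] measurable_sets[OF Z] by (intro indep_setD[OF indep']) auto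
    moreover have "(\<lambda>\<omega>. (Y \<omega>, Z \<omega>)) -` (A \<times> B) \<inter> space M = (Y -` A \<inter> space M) \<inter> (Z -` B \<inter> space M)"
      by auto
    ultimately show "emeasure (distr M S Y) A * emeasure (distr M R Z) B
        = emeasure (distr M (S \<Otimes>\<^sub>M R) (\<lambda>\<omega>. (Y \<omega>, Z \<omega>))) (A \<times> B)"
      by (simp add: emeasure_distr emeasure_eq_measure ennreal_mult)
  qed (auto intro!: sets_pair_measure_cong Y.sigma_finite_measure_axioms Z.sigma_finite_measure_axioms)
  have "(\<integral>\<^sup>+\<omega>. h (Y \<omega>) (Z \<omega>) \<partial>M) = (\<integral>\<^sup>+p. (\<lambda>(y, z). h y z) p \<partial>(distr M S Y \<Otimes>\<^sub>M distr M R Z))"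
    unfolding eq by (subst nn_integral_distr) auto
  also have "\<dots> = (\<integral>\<^sup>+y. (\<integral>\<^sup>+z. (\<lambda>(y, z). h y z) (y, z) \<partial>distr M R Z) \<partial>distr M S Y)"
    by (rule Z.nn_integral_fst[symmetric]) simp
  also have "\<dots> = (\<integral>\<^sup>+\<omega>. (\<integral>\<^sup>+z. h (Y \<omega>) z \<partial>distr M R Z) \<partial>M)"
    by (subst nn_integral_distr) (auto intro!: Z.borel_measurable_nn_integral)
  finally show ?thesis .
qed

section \<open>The stochastic oracle and descent in expectation\<close>

locale stochastic_subgradient = weakly_convex_constrained g X \<rho> fstar + P: prob_space P
  for g :: "'a::euclidean_space \<Rightarrow> real" and X \<rho> fstar and P :: "'b measure" +
  fixes G :: "'a \<Rightarrow> 'b \<Rightarrow> 'a" and L :: real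
  assumes L: "L > 0"
    and G_meas: "(\<lambda>(y, z). G y z) \<in> borel_measurable (restrict_space borel X \<Otimes>\<^sub>M P)"
    and G_int: "\<And>y. y \<in> X \<Longrightarrow> integrable P (\<lambda>z. (norm (G y z))\<^sup>2)"
    and G_bound: "\<And>y. y \<in> X \<Longrightarrow> (\<integral>z. (norm (G y z))\<^sup>2 \<partial>P) \<le> L\<^sup>2"
    and G_subdiff: "\<And>y. y \<in> X \<Longrightarrow> (\<integral>z. G y z \<partial>P) \<in> frechet_subdiff g y"
begin

text \<open>\<open>G\<close> is assumed measurable only over \<open>X\<close>, so the iterates are
  treated as random elements of \<open>X\<close>.\<close>

abbreviation SX :: "'a measure" where "SX \<equiv> restrict_space borel X"

abbreviation gap :: "'a \<Rightarrow> real" where "gap y \<equiv> env y - fstar"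

lemma gap_nonneg: "0 \<le> gap y"
  using env_ge by simp

lemma borel_measurable_env [measurable]: "env \<in> borel_measurable borel"
  by (intro borel_measurable_continuous_onI continuous_on_env)

lemma borel_measurable_gradient_env [measurable]: "gradient env \<in> borel_measurable borel"
  by (intro borel_measurable_continuous_onI continuous_on_gradient_env)

lemma measurable_SX_borel: "(\<lambda>y. y) \<in> measurable SX borel"
  by (rule measurable_restrict_space1) simp

lemma closest_point_X: "closest_point X y \<in> X"
  using X by (intro closest_point_in_set)

lemma measurable_closest_point [measurable]: "closest_point X \<in> measurable borel SX"
  by (intro measurable_restrict_space2 borel_measurable_continuous_onI continuous_on_closest_point X)
    (use closest_point_X in auto)

text \<open>The step size is an argument because it is random: it depends on the starting point of
  the inner run.\<close>

lemma measurable_projected_step: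
  "(\<lambda>(a, y, z). closest_point X (y - a *\<^sub>R G y z)) \<in> measurable ((borel :: real measure) \<Otimes>\<^sub>M (SX \<Otimes>\<^sub>M P)) SX"
proof -
  have [measurable]: "(\<lambda>p. G (fst (snd p)) (snd (snd p))) \<in> borel_measurable ((borel :: real measure) \<Otimes>\<^sub>M (SX \<Otimes>\<^sub>M P))"
    using measurable_compose[OF measurable_snd G_meas, of "borel :: real measure"]
    by (simp add: case_prod_beta)
  have [measurable]: "(\<lambda>p. fst (snd p)) \<in> borel_measurable ((borel :: real measure) \<Otimes>\<^sub>M (SX \<Otimes>\<^sub>M P))"
    by (rule measurable_compose[OF _ measurable_SX_borel]) measurable
  show ?thesis
    unfolding case_prod_beta by measurable
qed

lemma integrable_G:
  assumes y: "y \<in> X"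
  shows "integrable P (G y)"
proof -
  have [measurable]: "G y \<in> borel_measurable P"
    using measurable_compose[OF measurable_Pair1'[of y SX P] G_meas] y
    by (simp add: space_restrict_space)
  show ?thesis
  proof (rule Bochner_Integration.integrable_bound)
    show "integrable P (\<lambda>z. 1 + (norm (G y z))\<^sup>2)"
      using G_int[OF y] by simp
    have "norm (G y z) \<le> 1 + (norm (G y z))\<^sup>2" for z
      using sum_squares_bound[of 1 "norm (G y z)"] norm_ge_zero[of "G y z"]
      unfolding one_power2 mult_1_right by linarith
    then show "AE z in P. norm (G y z) \<le> norm (1 + (norm (G y z))\<^sup>2)"
      by (intro AE_I2) (simp add: abs_of_nonneg)
  qed simp
qed

text \<open>\<open>env_projected_step_le\<close> is integrated. The mean direction is a subgradient,
  so the linear term is at most \<open>- 2 * \<rho>\<^sup>2 * \<alpha> * (norm (y - prox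
  y))\<^sup>2\<close>, which is \<open>- \<alpha> / 2\<close> times the squared gradient norm. That
  term is moved to the left to avoid subtraction in \<open>ennreal\<close>.\<close>

lemma nn_integral_gap_step_le:
  assumes y: "y \<in> X" and \<alpha>: "\<alpha> \<ge> 0"
  shows "(\<integral>\<^sup>+z. ennreal (gap (closest_point X (y - \<alpha> *\<^sub>R G y z))) \<partial>P)
      + ennreal (\<alpha> / 2 * (norm (gradient env y))\<^sup>2)
    \<le> ennreal (gap y + \<alpha>\<^sup>2 * \<rho> * L\<^sup>2)"
proof -
  let ?d = "prox y - y"
  define B where "B z = gap y + 2 * \<rho> * \<alpha> * (G y z \<bullet> ?d) + \<rho> * \<alpha>\<^sup>2 * (norm (G y z))\<^sup>2" for z
  note [simp] = integrable_G[OF y] G_int[OF y]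
  have le: "gap (closest_point X (y - \<alpha> *\<^sub>R G y z)) \<le> B z" for z
    using env_projected_step_le[OF y, of \<alpha> "G y z"] by (simp add: B_def)
  have B: "integrable P B"
    unfolding B_def[abs_def] by simp
  have "(\<integral>\<^sup>+z. ennreal (gap (closest_point X (y - \<alpha> *\<^sub>R G y z))) \<partial>P) \<le> (\<integral>\<^sup>+z. ennreal (B z) \<partial>P)"
    by (intro nn_integral_mono ennreal_leI le)
  also have "\<dots> = ennreal (\<integral>z. B z \<partial>P)"
    using order_trans[OF gap_nonneg le] by (intro nn_integral_eq_integral B AE_I2)
  finally have 1: "(\<integral>\<^sup>+z. ennreal (gap (closest_point X (y - \<alpha> *\<^sub>R G y z))) \<partial>P) \<le> ennreal (\<integral>z. B z \<partial>P)" .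
  have "(\<integral>z. B z \<partial>P) = gap y + 2 * \<rho> * \<alpha> * ((\<integral>z. G y z \<partial>P) \<bullet> ?d) + \<rho> * \<alpha>\<^sup>2 * (\<integral>z. (norm (G y z))\<^sup>2 \<partial>P)"
    unfolding B_def by (simp add: P.prob_space)
  also have "\<dots> \<le> gap y + 2 * \<rho> * \<alpha> * (- \<rho> * (norm (y - prox y))\<^sup>2) + \<rho> * \<alpha>\<^sup>2 * L\<^sup>2"
    using rho \<alpha> inner_subgradient_prox_le[OF y G_subdiff[OF y]] G_bound[OF y]
    by (intro add_mono mult_left_mono) auto
  also have "\<dots> = gap y + \<alpha>\<^sup>2 * \<rho> * L\<^sup>2 - \<alpha> / 2 * (norm (gradient env y))\<^sup>2"
    by (simp add: norm_gradient_env_power2) (simp add: power2_eq_square)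
  finally have 2: "(\<integral>z. B z \<partial>P) + \<alpha> / 2 * (norm (gradient env y))\<^sup>2 \<le> gap y + \<alpha>\<^sup>2 * \<rho> * L\<^sup>2"
    by simp
  have 3: "0 \<le> (\<integral>z. B z \<partial>P)"
    using order_trans[OF gap_nonneg le] by (intro integral_nonneg_AE AE_I2)
  have "(\<integral>\<^sup>+z. ennreal (gap (closest_point X (y - \<alpha> *\<^sub>R G y z))) \<partial>P)
      + ennreal (\<alpha> / 2 * (norm (gradient env y))\<^sup>2)
    \<le> ennreal (\<integral>z. B z \<partial>P) + ennreal (\<alpha> / 2 * (norm (gradient env y))\<^sup>2)"
    by (rule add_right_mono[OF 1])
  also have "\<dots> = ennreal ((\<integral>z. B z \<partial>P) + \<alpha> / 2 * (norm (gradient env y))\<^sup>2)"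
    using 3 \<alpha> by (intro ennreal_plus[symmetric]) auto
  also have "\<dots> \<le> ennreal (gap y + \<alpha>\<^sup>2 * \<rho> * L\<^sup>2)"
    by (rule ennreal_leI[OF 2])
  finally show ?thesis .
qed

text \<open>Dropping the nonnegative integral from the descent inequality leaves a bound that
  involves no further sample.\<close>

lemma gradient_env_step_le:
  assumes "y \<in> X" and "\<alpha> \<ge> 0"
  shows "\<alpha> / 2 * (norm (gradient env y))\<^sup>2 \<le> gap y + \<alpha>\<^sup>2 * \<rho> * L\<^sup>2"
proof -
  have "ennreal (\<alpha> / 2 * (norm (gradient env y))\<^sup>2) \<le> ennreal (gap y + \<alpha>\<^sup>2 * \<rho> * L\<^sup>2)"
    using nn_integral_gap_step_le[OF assms] by (rule order_trans[rotated]) simp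
  moreover have "0 \<le> gap y + \<alpha>\<^sup>2 * \<rho> * L\<^sup>2"
    using gap_nonneg[of y] rho by simp
  ultimately show ?thesis by (simp add: ennreal_le_iff)
qed

lemma proj_subgrad_in: "y \<in> X \<Longrightarrow> proj_subgrad X G \<alpha> y z s \<in> X"
  by (cases s) (simp_all add: closest_point_X)

lemma proj_subgrad_0: "y \<in> X \<Longrightarrow> proj_subgrad X G 0 y z s = y"
  by (induction s) (simp_all add: closest_point_self)

end

section \<open>The restart scheme\<close>

locale restart_scheme = stochastic_subgradient g X \<rho> fstar P G L + prob_space M
  for g :: "'a::euclidean_space \<Rightarrow> real" and X \<rho> fstar and P :: "'b measure" and G L
    and M :: "'w measure" +
  fixes N t :: nat and \<xi> :: "nat \<Rightarrow> nat \<Rightarrow> 'w \<Rightarrow> 'b" and J :: "nat \<Rightarrow> 'w \<Rightarrow> nat" and x0 :: 'a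
  assumes sampling: "restart_sampling M P N t \<xi> J"
    and x0: "x0 \<in> X"
begin

abbreviation evs :: "(nat \<times> nat) + nat \<Rightarrow> 'w set set" where
  "evs \<equiv> sampling_events M P \<xi> J"

text \<open>Indices of what is drawn before sample \<open>s\<close> of outer iteration
  \<open>k\<close>. \<open>past k t\<close> holds all samples of that inner run but not its output
  index, and \<open>past N 0\<close> is the whole family.\<close>

definition past :: "nat \<Rightarrow> nat \<Rightarrow> ((nat \<times> nat) + nat) set" where
  "past k s = Inl ` ({..<k} \<times> {..<t} \<union> {k} \<times> {..<s}) \<union> Inr ` {..<k}"

definition step :: "'a \<Rightarrow> real" where
  "step y = sqrt (gap y) / (sqrt \<rho> * L * sqrt (real t + 1))"

definition outer :: "nat \<Rightarrow> 'w \<Rightarrow> 'a" where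
  "outer k \<omega> = restart_iter X G step x0 (\<lambda>i s. \<xi> i s \<omega>) (\<lambda>i. J i \<omega>) k"

definition inner_iter :: "nat \<Rightarrow> nat \<Rightarrow> 'w \<Rightarrow> 'a" where
  "inner_iter k s \<omega> = proj_subgrad X G (step (outer k \<omega>)) (outer k \<omega>) (\<lambda>i. \<xi> k i \<omega>) s"

lemma outer_0: "outer 0 \<omega> = x0"
  by (simp add: outer_def)

lemma outer_in: "outer k \<omega> \<in> X"
  unfolding outer_def by (induction k) (simp_all add: x0 proj_subgrad_in)

lemma inner_iter_in: "inner_iter k s \<omega> \<in> X"
  unfolding inner_iter_def by (rule proj_subgrad_in[OF outer_in])

lemma outer_Suc: "outer (Suc k) \<omega> = inner_iter k (J k \<omega>) \<omega>"
  by (simp add: inner_iter_def outer_def)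

lemma step_nonneg: "0 \<le> step y"
  using gap_nonneg[of y] rho L by (simp add: step_def)

lemma has_law_samples:
  "k < N \<Longrightarrow> s < t \<Longrightarrow> has_law M (\<xi> k s) P"
  "k < N \<Longrightarrow> has_law M (J k) (uniform_count_measure {0..t})"
  using sampling by (auto simp: restart_sampling_def)

lemma indep_sampling: "indep_sets evs (past N 0)"
  using sampling by (simp add: restart_sampling_def past_def)

lemma Int_stable_sampling: "Int_stable (evs i)"
proof (cases i)
  case (Inl p)
  then show ?thesis
    by (auto simp: sampling_events_def Int_stable_def split: prod.splits)
      (metis (no_types, opaque_lifting) Int_assoc Int_left_commute Int_absorb vimage_Int sets.Int)
next
  case (Inr k)
  then show ?thesis
    by (auto simp: sampling_events_def Int_stable_def)
      (metis (no_types, opaque_lifting) Int_assoc Int_left_commute Int_absorb vimage_Int)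
qed

lemma sets_history_sampling: "sets (history M evs I) = sigma_sets (space M) (\<Union>i\<in>I. evs i)"
  by (rule sets_history) (auto simp: sampling_events_def split: sum.splits prod.splits)

lemma measurable_sample:
  assumes "Inl (k, s) \<in> I" "k < N" "s < t"
  shows "\<xi> k s \<in> measurable (history M evs I) P"
proof (rule measurableI)
  show "\<xi> k s \<omega> \<in> space P" if "\<omega> \<in> space (history M evs I)" for \<omega>
    using has_law_samples(1)[OF assms(2,3)] that by (auto simp: has_law_def dest: measurable_space)
  fix A assume "A \<in> sets P"
  then have "\<xi> k s -` A \<inter> space M \<in> evs (Inl (k, s))"
    by (auto simp: sampling_events_def)
  then show "\<xi> k s -` A \<inter> space (history M evs I) \<in> sets (history M evs I)"
    unfolding sets_history_sampling using assms(1) by auto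
qed

lemma measurable_index:
  assumes "Inr k \<in> I" "k < N"
  shows "J k \<in> measurable (history M evs I) (count_space {0..t})"
proof (rule measurableI)
  show "J k \<omega> \<in> space (count_space {0..t})" if "\<omega> \<in> space (history M evs I)" for \<omega>
    using has_law_samples(2)[OF assms(2)] that
    by (auto simp: has_law_def space_uniform_count_measure dest!: measurable_space)
  fix A :: "nat set"
  have "J k -` A \<inter> space M \<in> evs (Inr k)"
    by (auto simp: sampling_events_def)
  then show "J k -` A \<inter> space (history M evs I) \<in> sets (history M evs I)"
    unfolding sets_history_sampling using assms(1) by auto
qed

lemma index_le: "k < N \<Longrightarrow> \<omega> \<in> space M \<Longrightarrow> J k \<omega> \<le> t"
  using measurable_space[OF measurable_index[of k "{Inr k}"], of \<omega>] by simp

lemma measurable_step: "step \<in> borel_measurable SX"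
  unfolding step_def[abs_def] by (rule measurable_compose[OF measurable_SX_borel]) measurable

text \<open>Induction over \<open>s\<close> inside an inner run, nested in an induction over
  \<open>k\<close>. Any superset \<open>I\<close> of the past is allowed, so that one block can
  serve all iterates of an inner run.\<close>

lemma measurable_iterates_history:
  shows "k \<le> N \<Longrightarrow> past k 0 \<subseteq> I \<Longrightarrow> outer k \<in> measurable (history M evs I) SX"
    and "k < N \<Longrightarrow> s \<le> t \<Longrightarrow> past k s \<subseteq> I \<Longrightarrow> inner_iter k s \<in> measurable (history M evs I) SX"
proof -
  have inner: "inner_iter k s \<in> measurable (history M evs I) SX"
    if outer: "outer k \<in> measurable (history M evs I) SX"
      and "k < N" "s \<le> t" "past k s \<subseteq> I" for k s
    using that(2-)
  proof (induction s)
    case 0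
    then show ?case using outer by (simp add: inner_iter_def[abs_def])
  next
    case (Suc s)
    have [measurable]: "inner_iter k s \<in> measurable (history M evs I) SX"
      using Suc by (intro Suc.IH) (auto simp: past_def)
    have [measurable]: "\<xi> k s \<in> measurable (history M evs I) P"
      using Suc by (intro measurable_sample) (auto simp: past_def)
    have "(\<lambda>\<omega>. step (outer k \<omega>)) \<in> borel_measurable (history M evs I)"
      by (rule measurable_compose[OF outer measurable_step])
    then have "(\<lambda>\<omega>. (step (outer k \<omega>), inner_iter k s \<omega>, \<xi> k s \<omega>))
        \<in> measurable (history M evs I) (borel \<Otimes>\<^sub>M (SX \<Otimes>\<^sub>M P))"
      by measurable
    from measurable_compose[OF this measurable_projected_step]
    show ?case by (simp add: inner_iter_def[abs_def])
  qed
  have outer: "outer k \<in> measurable (history M evs I) SX" if "k \<le> N" "past k 0 \<subseteq> I" for k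
    using that
  proof (induction k)
    case 0
    then show ?case using x0 by (simp add: outer_0[abs_def] space_restrict_space)
  next
    case (Suc k)
    have IH: "outer k \<in> measurable (history M evs I) SX"
      using Suc by (intro Suc.IH) (auto simp: past_def)
    show ?case
      unfolding outer_Suc[abs_def]
    \<comment> \<open>The output index is itself random, but it takes finitely many values and the
      iterate is adapted for each of them.\<close>
    proof (rule measurable_compose_countable'[where I = "{0..t}"])
      show "inner_iter k i \<in> measurable (history M evs I) SX" if "i \<in> {0..t}" for i
        using Suc.prems that by (intro inner[OF IH]) (auto simp: past_def)
      show "J k \<in> measurable (history M evs I) (count_space {0..t})"
        using Suc.prems by (intro measurable_index) (auto simp: past_def)
    qed simp
  qed
  show "k \<le> N \<Longrightarrow> past k 0 \<subseteq> I \<Longrightarrow> outer k \<in> measurable (history M evs I) SX"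
    by (rule outer)
  show "k < N \<Longrightarrow> s \<le> t \<Longrightarrow> past k s \<subseteq> I \<Longrightarrow> inner_iter k s \<in> measurable (history M evs I) SX"
    by (rule inner[OF outer]) (auto simp: past_def)
qed

lemma measurable_history_imp:
  assumes "Y \<in> measurable (history M evs I) S" "I \<subseteq> past N 0"
  shows "Y \<in> measurable M S"
proof -
  have "evs i \<subseteq> sets M" if "i \<in> past N 0" for i
    using indep_sampling that by (auto simp: indep_sets_def)
  then have "sets (history M evs I) \<subseteq> sets M"
    unfolding sets_history_sampling using assms(2) by (intro sets.sigma_sets_subset) auto
  from measurable_mono[OF order_refl refl this, of S] assms(1) show ?thesis by auto
qed

lemma measurable_outer: "k \<le> N \<Longrightarrow> outer k \<in> measurable M SX"
  by (rule measurable_history_imp[OF measurable_iterates_history(1)[OF _ order_refl]])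
    (auto simp: past_def)

lemma measurable_inner_iter: "k < N \<Longrightarrow> s \<le> t \<Longrightarrow> inner_iter k s \<in> measurable M SX"
  by (rule measurable_history_imp[OF measurable_iterates_history(2)[OF _ _ order_refl]])
    (auto simp: past_def)

section \<open>Integrating out fresh samples and output indices\<close>

text \<open>\<open>\<xi> k s\<close> is independent of everything in \<open>past k s\<close>. The
  starting point \<open>outer k\<close> accompanies the current iterate because the step size
  depends on it.\<close>

lemma nn_integral_fresh_sample:
  assumes k: "k < N" and s: "s < t"
    and h: "(\<lambda>(p, z). h p z) \<in> borel_measurable ((SX \<Otimes>\<^sub>M SX) \<Otimes>\<^sub>M P)"
  shows "(\<integral>\<^sup>+\<omega>. h (outer k \<omega>, inner_iter k s \<omega>) (\<xi> k s \<omega>) \<partial>M)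
    = (\<integral>\<^sup>+\<omega>. (\<integral>\<^sup>+z. h (outer k \<omega>, inner_iter k s \<omega>) z \<partial>P) \<partial>M)"
proof -
  have "(\<integral>\<^sup>+\<omega>. h (outer k \<omega>, inner_iter k s \<omega>) (\<xi> k s \<omega>) \<partial>M)
    = (\<integral>\<^sup>+\<omega>. (\<integral>\<^sup>+z. h (outer k \<omega>, inner_iter k s \<omega>) z \<partial>distr M P (\<xi> k s)) \<partial>M)"
  proof (rule nn_integral_indep_histories[OF indep_sampling Int_stable_sampling])
    show "past k s \<subseteq> past N 0" "{Inl (k, s)} \<subseteq> past N 0" "past k s \<inter> {Inl (k, s)} = {}"
      using k s by (auto simp: past_def)
    show "(\<lambda>\<omega>. (outer k \<omega>, inner_iter k s \<omega>)) \<in> measurable (history M evs (past k s)) (SX \<Otimes>\<^sub>M SX)"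
      using k s by (intro measurable_Pair measurable_iterates_history) (auto simp: past_def)
    show "\<xi> k s \<in> measurable (history M evs {Inl (k, s)}) P"
      using k s by (intro measurable_sample) auto
  qed (rule h)
  then show ?thesis
    using has_law_samples(1)[OF k s] by (simp add: has_law_def)
qed

text \<open>The integrand is split over the values of \<open>J k\<close>. As \<open>J k\<close> is
  uniform and independent of the whole inner run, this gives the plain average over all
  \<open>t + 1\<close> iterates, the last one included.\<close>

lemma nn_integral_output:
  assumes k: "k < N" and h[measurable]: "h \<in> borel_measurable SX"
  shows "(\<integral>\<^sup>+\<omega>. h (outer (Suc k) \<omega>) \<partial>M) = (\<Sum>s\<le>t. \<integral>\<^sup>+\<omega>. h (inner_iter k s \<omega>) \<partial>M) * ennreal (1 / (real t + 1))"
proof -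
  have "distr M (count_space {0..t}) (J k) = distr M (uniform_count_measure {0..t}) (J k)"
    by (rule distr_cong) (simp_all add: sets_uniform_count_measure)
  also have "\<dots> = uniform_count_measure {0..t}"
    using has_law_samples(2)[OF k] by (simp add: has_law_def)
  finally have unif: "distr M (count_space {0..t}) (J k) = uniform_count_measure {0..t}" .
  have "(\<integral>\<^sup>+\<omega>. h (outer (Suc k) \<omega>) \<partial>M) = (\<integral>\<^sup>+\<omega>. (\<Sum>s\<le>t. h (inner_iter k s \<omega>) * indicator {s} (J k \<omega>)) \<partial>M)"
  proof (rule nn_integral_cong)
    fix \<omega> assume "\<omega> \<in> space M"
    then have "J k \<omega> \<in> {..t}" using index_le[OF k] by simp
    then show "h (outer (Suc k) \<omega>) = (\<Sum>s\<le>t. h (inner_iter k s \<omega>) * indicator {s} (J k \<omega>))"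
      unfolding outer_Suc by (subst sum.remove[of _ "J k \<omega>"]) (auto simp: indicator_def)
  qed
  also have "\<dots> = (\<Sum>s\<le>t. \<integral>\<^sup>+\<omega>. h (inner_iter k s \<omega>) * indicator {s} (J k \<omega>) \<partial>M)"
  proof (rule nn_integral_sum)
    fix s assume "s \<in> {..t}"
    then have [measurable]: "inner_iter k s \<in> measurable M SX"
      using measurable_inner_iter k by simp
    have [measurable]: "J k \<in> measurable M (count_space {0..t})"
      using k by (intro measurable_history_imp[OF measurable_index[of k "{Inr k}"]]) (auto simp: past_def)
    have "(\<lambda>\<omega>. indicator {s} (J k \<omega>) :: ennreal) \<in> borel_measurable M"
      by (rule measurable_compose[where N = "count_space {0..t}"]) simp_all
    then show "(\<lambda>\<omega>. h (inner_iter k s \<omega>) * indicator {s} (J k \<omega>)) \<in> borel_measurable M"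
      by measurable
  qed
  also have "\<dots> = (\<Sum>s\<le>t. (\<integral>\<^sup>+\<omega>. h (inner_iter k s \<omega>) \<partial>M) * ennreal (1 / (real t + 1)))"
  proof (rule sum.cong[OF refl])
    fix s assume s: "s \<in> {..t}"
    then have [measurable]: "inner_iter k s \<in> measurable M SX"
      using measurable_inner_iter k by simp
    have "(\<integral>\<^sup>+\<omega>. h (inner_iter k s \<omega>) * indicator {s} (J k \<omega>) \<partial>M)
        = (\<integral>\<^sup>+\<omega>. (\<integral>\<^sup>+j. h (inner_iter k s \<omega>) * indicator {s} j \<partial>distr M (count_space {0..t}) (J k)) \<partial>M)"
    proof (rule nn_integral_indep_histories[OF indep_sampling Int_stable_sampling,
          where h = "\<lambda>y j. h y * indicator {s} j"])
      show "past k t \<subseteq> past N 0" "{Inr k} \<subseteq> past N 0" "past k t \<inter> {Inr k} = {}"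
        using k by (auto simp: past_def)
      show "inner_iter k s \<in> measurable (history M evs (past k t)) SX"
        using k s by (intro measurable_iterates_history) (auto simp: past_def)
      show "J k \<in> measurable (history M evs {Inr k}) (count_space {0..t})"
        using k by (intro measurable_index) auto
      have "(\<lambda>p. indicator {s} (snd p) :: ennreal) \<in> borel_measurable (SX \<Otimes>\<^sub>M count_space {0..t})"
        by (rule measurable_compose[OF measurable_snd]) simp
      then show "(\<lambda>(y, j). h y * indicator {s} j) \<in> borel_measurable (SX \<Otimes>\<^sub>M count_space {0..t})"
        unfolding case_prod_beta by measurable
    qed
    also have "\<dots> = (\<integral>\<^sup>+\<omega>. h (inner_iter k s \<omega>) * ennreal (1 / (real t + 1)) \<partial>M)"
      unfolding unif using s by (intro nn_integral_cong, subst nn_integral_cmult)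
        (auto simp: nn_integral_indicator emeasure_uniform_count_measure sets_uniform_count_measure add.commute)
    also have "\<dots> = (\<integral>\<^sup>+\<omega>. h (inner_iter k s \<omega>) \<partial>M) * ennreal (1 / (real t + 1))"
      by (rule nn_integral_multc) simp
    finally show "(\<integral>\<^sup>+\<omega>. h (inner_iter k s \<omega>) * indicator {s} (J k \<omega>) \<partial>M)
        = (\<integral>\<^sup>+\<omega>. h (inner_iter k s \<omega>) \<partial>M) * ennreal (1 / (real t + 1))" .
  qed
  finally show ?thesis by (simp add: sum_distrib_right)
qed


lemma step_eq_0_iff: "step y = 0 \<longleftrightarrow> gap y = 0"
  using rho L by (simp add: step_def add_nonneg_pos[THEN less_imp_neq, THEN not_sym])

lemma gradient_env_inner_iter_eq_0:
  assumes "step (outer k \<omega>) = 0"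
  shows "gradient env (inner_iter k s \<omega>) = 0"
proof -
  have "gap (outer k \<omega>) = 0" using assms unfolding step_eq_0_iff .
  moreover have "inner_iter k s \<omega> = outer k \<omega>"
    unfolding inner_iter_def assms by (rule proj_subgrad_0[OF outer_in])
  ultimately have "(norm (gradient env (inner_iter k s \<omega>)))\<^sup>2 \<le> 0"
    using gradient_env_le[of "outer k \<omega>"] by simp
  then show ?thesis by simp
qed

text \<open>The step size depends on the random starting point of the inner run, so the one-step descent
  inequality is divided by it before integrating and telescoping; this avoids conditional
  expectations. Where the step size is \<open>0\<close>, the quotients are \<open>0\<close> in HOL, but then the inner run
  never leaves a minimizer of the envelope and the gradient vanishes as well. The last inner iterate
  has no further sample, so its term is estimated pointwise.\<close>

lemma nn_integral_gradient_outer_Suc_le: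
  assumes k: "k < N"
  shows "(\<integral>\<^sup>+\<omega>. ennreal ((norm (gradient env (outer (Suc k) \<omega>)))\<^sup>2) \<partial>M)
    \<le> ennreal (4 * L * sqrt (\<rho> / (real t + 1))) * (\<integral>\<^sup>+\<omega>. ennreal (sqrt (gap (outer k \<omega>))) \<partial>M)"
proof -
  \<comment> \<open>Since \<open>step y = sqrt (gap y) / \<kappa>\<close>, both the initial term
    \<open>gap / step\<close> and the noise term \<open>step * \<rho> * L\<^sup>2\<close> become
    multiples of \<open>sqrt gap\<close>, hence of \<open>Q\<close> after integration.\<close>
  define \<kappa> where "\<kappa> = sqrt \<rho> * L * sqrt (real t + 1)"
  have \<kappa>: "\<kappa> > 0" using rho L by (simp add: \<kappa>_def add_nonneg_pos)
  have step: "step y = sqrt (gap y) / \<kappa>" for y by (simp add: \<kappa>_def step_def)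
  define A where "A s = (\<integral>\<^sup>+\<omega>. ennreal (gap (inner_iter k s \<omega>) / step (outer k \<omega>)) \<partial>M)" for s
  define B where "B s = (\<integral>\<^sup>+\<omega>. ennreal ((norm (gradient env (inner_iter k s \<omega>)))\<^sup>2 / 2) \<partial>M)" for s
  define Q where "Q = (\<integral>\<^sup>+\<omega>. ennreal (sqrt (gap (outer k \<omega>))) \<partial>M)"
  define e where "e = (\<integral>\<^sup>+\<omega>. ennreal (step (outer k \<omega>) * \<rho> * L\<^sup>2) \<partial>M)"
  have outer_m: "outer k \<in> measurable M SX"
    using k by (intro measurable_outer) simp
  have outer_b [measurable]: "outer k \<in> borel_measurable M"
    by (rule measurable_compose[OF outer_m measurable_SX_borel])
  have [measurable]: "(\<lambda>\<omega>. step (outer k \<omega>)) \<in> borel_measurable M"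
    by (rule measurable_compose[OF outer_m measurable_step])
  have inner_b [measurable]: "inner_iter k s \<in> borel_measurable M" if "s \<le> t" for s
    by (rule measurable_compose[OF measurable_inner_iter[OF k that] measurable_SX_borel])
  have A0: "A 0 = ennreal \<kappa> * Q"
  proof -
    have "gap y / step y = \<kappa> * sqrt (gap y)" for y
      using gap_nonneg[of y] \<kappa> unfolding step by (cases "gap y = 0") (auto simp: field_simps)
    then show ?thesis
      unfolding A_def Q_def using \<kappa> gap_nonneg
      by (subst nn_integral_cmult[symmetric]) (auto simp: inner_iter_def ennreal_mult)
  qed
  have e: "e = ennreal (\<rho> * L\<^sup>2 / \<kappa>) * Q"
    unfolding e_def Q_def using \<kappa> gap_nonneg rho
    by (subst nn_integral_cmult[symmetric]) (auto simp: step ennreal_mult[symmetric] mult_ac intro!: nn_integral_cong)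
  have last: "B s \<le> A s + e" if "s \<le> t" for s
  proof -
    note [measurable] = inner_b[OF that]
    have "B s \<le> (\<integral>\<^sup>+\<omega>. ennreal (gap (inner_iter k s \<omega>) / step (outer k \<omega>))
        + ennreal (step (outer k \<omega>) * \<rho> * L\<^sup>2) \<partial>M)"
      unfolding B_def
    proof (rule nn_integral_mono)
      fix \<omega>
      define a where "a = step (outer k \<omega>)"
      have a: "a \<ge> 0" unfolding a_def by (rule step_nonneg)
      have "(norm (gradient env (inner_iter k s \<omega>)))\<^sup>2 / 2 \<le> gap (inner_iter k s \<omega>) / a + a * \<rho> * L\<^sup>2"
      proof (cases "a = 0")
        case True
        then show ?thesis
          using gradient_env_inner_iter_eq_0[of k \<omega> s] by (simp add: a_def)
      next
        case False
        then show ?thesis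
          using gradient_env_step_le[OF inner_iter_in a, of k s \<omega>] a
          by (simp add: field_simps power2_eq_square)
      qed
      from ennreal_leI[OF this]
      show "ennreal ((norm (gradient env (inner_iter k s \<omega>)))\<^sup>2 / 2)
          \<le> ennreal (gap (inner_iter k s \<omega>) / step (outer k \<omega>)) + ennreal (step (outer k \<omega>) * \<rho> * L\<^sup>2)"
        unfolding a_def[symmetric]
        by (subst (asm) ennreal_plus)
          (use a rho divide_nonneg_nonneg[OF gap_nonneg a] in \<open>auto intro!: mult_nonneg_nonneg\<close>)
    qed
    also have "\<dots> = A s + e"
      unfolding A_def e_def by (rule nn_integral_add) measurable
    finally show ?thesis .
  qed
  have descent: "A (Suc s) + B s \<le> A s + e" if s: "s < t" for s
  proof -
    note [measurable] = inner_b[OF less_imp_le[OF s]]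
    let ?next = "\<lambda>a y z. closest_point X (y - a *\<^sub>R G y z)"
    \<comment> \<open>The next quotient as a function of the past pair and the new sample: the
      sample is integrated out first, and the one-step inequality is then applied with the past held
      fixed.\<close>
    define h where "h = (\<lambda>(x, y) z. ennreal (gap (?next (step x) y z) / step x))"
    have h: "(\<lambda>(p, z). h p z) \<in> borel_measurable ((SX \<Otimes>\<^sub>M SX) \<Otimes>\<^sub>M P)"
    proof -
      have a: "(\<lambda>q. step (fst (fst q))) \<in> borel_measurable ((SX \<Otimes>\<^sub>M SX) \<Otimes>\<^sub>M P)"
        by (rule measurable_compose[OF _ measurable_step]) measurable
      then have "(\<lambda>q. (step (fst (fst q)), snd (fst q), snd q))
          \<in> measurable ((SX \<Otimes>\<^sub>M SX) \<Otimes>\<^sub>M P) (borel \<Otimes>\<^sub>M (SX \<Otimes>\<^sub>M P))"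
        by measurable
      from measurable_compose[OF this measurable_projected_step]
      have "(\<lambda>q. ?next (step (fst (fst q))) (snd (fst q)) (snd q)) \<in> measurable ((SX \<Otimes>\<^sub>M SX) \<Otimes>\<^sub>M P) SX"
        by (simp only: prod.case)
      from measurable_compose[OF this measurable_SX_borel] a show ?thesis
        unfolding h_def case_prod_beta by measurable
    qed
    have hm: "(\<lambda>\<omega>. \<integral>\<^sup>+z. h (outer k \<omega>, inner_iter k s \<omega>) z \<partial>P) \<in> borel_measurable M"
      by (rule measurable_compose[OF measurable_Pair[OF outer_m measurable_inner_iter[OF k]]
            P.borel_measurable_nn_integral[OF h]]) (use s in simp)
    have "A (Suc s) = (\<integral>\<^sup>+\<omega>. h (outer k \<omega>, inner_iter k s \<omega>) (\<xi> k s \<omega>) \<partial>M)"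
      by (simp add: A_def h_def inner_iter_def)
    also have "\<dots> = (\<integral>\<^sup>+\<omega>. (\<integral>\<^sup>+z. h (outer k \<omega>, inner_iter k s \<omega>) z \<partial>P) \<partial>M)"
      by (rule nn_integral_fresh_sample[OF k s h])
    finally have "A (Suc s) + B s = (\<integral>\<^sup>+\<omega>. (\<integral>\<^sup>+z. h (outer k \<omega>, inner_iter k s \<omega>) z \<partial>P)
        + ennreal ((norm (gradient env (inner_iter k s \<omega>)))\<^sup>2 / 2) \<partial>M)"
      unfolding B_def using hm by (subst nn_integral_add) auto
    also have "\<dots> \<le> (\<integral>\<^sup>+\<omega>. ennreal (gap (inner_iter k s \<omega>) / step (outer k \<omega>))
        + ennreal (step (outer k \<omega>) * \<rho> * L\<^sup>2) \<partial>M)"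
    proof (rule nn_integral_mono)
      fix \<omega>
      define a where "a = step (outer k \<omega>)"
      define y where "y = inner_iter k s \<omega>"
      have a: "a \<ge> 0" unfolding a_def by (rule step_nonneg)
      have y: "y \<in> X" unfolding y_def by (rule inner_iter_in)
      have "(\<integral>\<^sup>+z. ennreal (gap (?next a y z) / a) \<partial>P) + ennreal ((norm (gradient env y))\<^sup>2 / 2)
          \<le> ennreal (gap y / a) + ennreal (a * \<rho> * L\<^sup>2)"
      proof (cases "a = 0")
        case True
        then show ?thesis
          using gradient_env_inner_iter_eq_0[of k \<omega> s] by (simp add: a_def y_def)
      next
        case False
        with a have a: "a > 0" by simp
        have "(\<lambda>z. (a, y, z)) \<in> measurable P (borel \<Otimes>\<^sub>M (SX \<Otimes>\<^sub>M P))"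
          using y by (intro measurable_Pair measurable_const) (auto simp: space_restrict_space)
        from measurable_compose[OF measurable_compose[OF this measurable_projected_step] measurable_SX_borel]
        have [measurable]: "?next a y \<in> borel_measurable P" by simp
        have "(\<integral>\<^sup>+z. ennreal (gap (?next a y z) / a) \<partial>P) = ennreal (1 / a) * (\<integral>\<^sup>+z. ennreal (gap (?next a y z)) \<partial>P)"
          using a gap_nonneg by (subst nn_integral_cmult[symmetric]) (auto simp: ennreal_mult[symmetric])
        moreover have "ennreal ((norm (gradient env y))\<^sup>2 / 2)
            = ennreal (1 / a) * ennreal (a / 2 * (norm (gradient env y))\<^sup>2)"
          using a by (subst ennreal_mult[symmetric]) auto
        moreover have "ennreal (gap y / a) + ennreal (a * \<rho> * L\<^sup>2) = ennreal (1 / a) * ennreal (gap y + a\<^sup>2 * \<rho> * L\<^sup>2)"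
          using a gap_nonneg[of y] rho L
          by (subst ennreal_mult[symmetric], simp, simp, subst ennreal_plus[symmetric])
            (auto simp: field_simps power2_eq_square simp del: ennreal_plus)
        ultimately show ?thesis
          using mult_left_mono[OF nn_integral_gap_step_le[OF y less_imp_le[OF a]], of "ennreal (1 / a)"]
          by (simp add: distrib_left)
      qed
      then show "(\<integral>\<^sup>+z. h (outer k \<omega>, inner_iter k s \<omega>) z \<partial>P)
            + ennreal ((norm (gradient env (inner_iter k s \<omega>)))\<^sup>2 / 2)
          \<le> ennreal (gap (inner_iter k s \<omega>) / step (outer k \<omega>)) + ennreal (step (outer k \<omega>) * \<rho> * L\<^sup>2)"
        by (simp add: h_def a_def y_def)
    qed
    also have "\<dots> = A s + e"
      unfolding A_def e_def by (rule nn_integral_add) measurable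
    finally show ?thesis .
  qed
  have telescope: "A n + (\<Sum>s<n. B s) \<le> A 0 + of_nat n * e" if "n \<le> t" for n
    using that
  proof (induction n)
    case (Suc n)
    have "A (Suc n) + (\<Sum>s<Suc n. B s) = (A (Suc n) + B n) + (\<Sum>s<n. B s)"
      by (simp add: ac_simps)
    also have "\<dots> \<le> (A n + e) + (\<Sum>s<n. B s)"
      using Suc.prems by (intro add_right_mono descent) simp
    also have "\<dots> = (A n + (\<Sum>s<n. B s)) + e" by (simp add: ac_simps)
    also have "\<dots> \<le> (A 0 + of_nat n * e) + e"
      using Suc by (intro add_right_mono Suc.IH) simp
    finally show ?case by (simp add: algebra_simps)
  qed simp
  \<comment> \<open>The steps \<open>s < t\<close> telescope, and the last iterate contributes one
    more \<open>e\<close>, which makes \<open>t + 1\<close> noise terms.\<close>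
  have "(\<Sum>s\<le>t. B s) = (\<Sum>s<t. B s) + B t"
    by (simp add: lessThan_Suc_atMost[symmetric])
  also have "\<dots> \<le> (\<Sum>s<t. B s) + (A t + e)"
    by (intro add_left_mono last) simp
  also have "\<dots> = (A t + (\<Sum>s<t. B s)) + e" by (simp add: ac_simps)
  also have "\<dots> \<le> (A 0 + of_nat t * e) + e"
    by (intro add_right_mono telescope) simp
  also have "\<dots> = ennreal \<kappa> * Q + ennreal (real t + 1) * (ennreal (\<rho> * L\<^sup>2 / \<kappa>) * Q)"
    unfolding A0 e by (simp add: ennreal_plus ennreal_of_nat_eq_real_of_nat distrib_right add.assoc)
  also have "\<dots> = (ennreal \<kappa> + ennreal (real t + 1) * ennreal (\<rho> * L\<^sup>2 / \<kappa>)) * Q"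
    by (simp only: distrib_right mult.assoc)
  also have "ennreal \<kappa> + ennreal (real t + 1) * ennreal (\<rho> * L\<^sup>2 / \<kappa>)
      = ennreal (\<kappa> + (real t + 1) * (\<rho> * L\<^sup>2 / \<kappa>))"
  proof -
    have "0 \<le> real t + 1" "0 \<le> \<rho> * L\<^sup>2 / \<kappa>" "0 \<le> \<kappa>"
      using rho \<kappa> by auto
    then show ?thesis
      by (simp only: ennreal_mult ennreal_plus mult_nonneg_nonneg)
  qed
  \<comment> \<open>The step size balances the two contributions:
    \<open>(t + 1) * \<rho> * L\<^sup>2 = \<kappa>\<^sup>2\<close>, so each of them equals
    \<open>\<kappa>\<close>.\<close>
  also have "\<kappa> + (real t + 1) * (\<rho> * L\<^sup>2 / \<kappa>) = 2 * \<kappa>"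
  proof -
    have "(real t + 1) * (\<rho> * L\<^sup>2) = \<kappa>\<^sup>2"
      using rho by (simp add: \<kappa>_def power_mult_distrib)
    then show ?thesis using \<kappa> by (simp add: power2_eq_square)
  qed
  finally have sum_B: "(\<Sum>s\<le>t. B s) \<le> ennreal (2 * \<kappa>) * Q" .
  have "(\<integral>\<^sup>+\<omega>. ennreal ((norm (gradient env (outer (Suc k) \<omega>)))\<^sup>2) \<partial>M)
      = (\<Sum>s\<le>t. \<integral>\<^sup>+\<omega>. ennreal ((norm (gradient env (inner_iter k s \<omega>)))\<^sup>2) \<partial>M) * ennreal (1 / (real t + 1))"
    by (rule nn_integral_output[OF k]) (rule measurable_compose[OF measurable_SX_borel], measurable)
  also have "(\<Sum>s\<le>t. \<integral>\<^sup>+\<omega>. ennreal ((norm (gradient env (inner_iter k s \<omega>)))\<^sup>2) \<partial>M) = ennreal 2 * (\<Sum>s\<le>t. B s)"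
    unfolding sum_distrib_left
  proof (rule sum.cong[OF refl])
    fix s assume "s \<in> {..t}"
    then have [measurable]: "inner_iter k s \<in> borel_measurable M" by (intro inner_b) simp
    show "(\<integral>\<^sup>+\<omega>. ennreal ((norm (gradient env (inner_iter k s \<omega>)))\<^sup>2) \<partial>M) = ennreal 2 * B s"
      unfolding B_def
      by (subst nn_integral_cmult[symmetric]) (auto simp: ennreal_mult[symmetric] simp del: ennreal_numeral)
  qed
  also have "ennreal 2 * (\<Sum>s\<le>t. B s) * ennreal (1 / (real t + 1))
      \<le> ennreal 2 * (ennreal (2 * \<kappa>) * Q) * ennreal (1 / (real t + 1))"
    by (intro mult_right_mono mult_left_mono sum_B) auto
  also have "\<dots> = (ennreal 2 * ennreal (2 * \<kappa>) * ennreal (1 / (real t + 1))) * Q"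
    by (simp only: mult_ac)
  also have "ennreal 2 * ennreal (2 * \<kappa>) * ennreal (1 / (real t + 1)) = ennreal (2 * (2 * \<kappa>) * (1 / (real t + 1)))"
  proof -
    have "0 \<le> (2::real)" "0 \<le> 2 * \<kappa>" "0 \<le> 1 / (real t + 1)"
      using \<kappa> by auto
    then show ?thesis
      by (simp only: ennreal_mult mult_nonneg_nonneg)
  qed
  also have "2 * (2 * \<kappa>) * (1 / (real t + 1)) = 4 * L * sqrt (\<rho> / (real t + 1))"
  proof -
    have "sqrt (real t + 1) / (real t + 1) = 1 / sqrt (real t + 1)"
      using real_sqrt_mult_self[of "real t + 1"] by (simp add: field_simps add_nonneg_pos)
    moreover have "2 * (2 * \<kappa>) * (1 / (real t + 1)) = 4 * L * sqrt \<rho> * (sqrt (real t + 1) / (real t + 1))"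
      by (simp add: \<kappa>_def)
    ultimately show ?thesis by (simp add: real_sqrt_divide)
  qed
  finally show ?thesis by (simp only: Q_def)
qed

end

section \<open>Moment recursion along the restarts\<close>

text \<open>The sequence \<open>m\<close> solves the restart recursion with equality, so the
  induction over restarts loses nothing. Constants and powers of \<open>C / \<tau>\<close> are
  matched separately.\<close>

lemma restart_rate_recursion:
  fixes c D \<rho> L \<tau> \<theta> C :: real
  assumes pos: "c > 0" "D > 0" "\<rho> > 0" "L > 0" "\<tau> > 0" and \<theta>: "\<theta> \<ge> 1/2"
    and C: "C = 16 * c powr (- 4) * D powr (1 - 4 * \<theta>) * \<rho> * L\<^sup>2"
  defines "m \<equiv> \<lambda>k::nat. D * (C / \<tau>) powr ((1 - (4 * \<theta>) powr (- real k)) / (4 * \<theta> - 1))"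
  shows "4 * L * sqrt (\<rho> / \<tau>) * sqrt (m k) = c\<^sup>2 * m (Suc k) powr (2 * \<theta>)"
proof -
  define B where "B = C / \<tau>"
  define e where "e = (4 * \<theta>) powr (- real k)"
  have C0: "C > 0" using pos by (simp add: C)
  have B: "B > 0" using pos C0 by (simp add: B_def)
  \<comment> \<open>This identity explains the value of \<open>C\<close>: it is the one with
    \<open>c powr 4 * D powr (4 * \<theta> - 1) * C = 16 * \<rho> * L\<^sup>2\<close>.\<close>
  have "(c\<^sup>2 * D powr ((4 * \<theta> - 1) / 2))\<^sup>2 * B = (4 * L)\<^sup>2 * (\<rho> / \<tau>)"
  proof -
    have "(c\<^sup>2 * D powr ((4 * \<theta> - 1) / 2))\<^sup>2 = c powr 4 * D powr (4 * \<theta> - 1)"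
      using pos by (simp add: power_mult_distrib power2_eq_square[of "D powr _"] powr_add[symmetric])
    moreover have "c powr 4 * c powr (- 4) = 1" "D powr (4 * \<theta> - 1) * D powr (1 - 4 * \<theta>) = 1"
      using pos by (simp add: powr_minus, simp add: powr_add[symmetric])
    moreover have "(c powr 4 * D powr (4 * \<theta> - 1)) * C
        = 16 * (c powr 4 * c powr (- 4)) * (D powr (4 * \<theta> - 1) * D powr (1 - 4 * \<theta>)) * (\<rho> * L\<^sup>2)"
      unfolding C by (simp only: mult_ac)
    ultimately have "(c\<^sup>2 * D powr ((4 * \<theta> - 1) / 2))\<^sup>2 * C = 16 * (\<rho> * L\<^sup>2)"
      by simp
    then show ?thesis by (simp add: B_def power_mult_distrib)
  qed
  then have "sqrt ((c\<^sup>2 * D powr ((4 * \<theta> - 1) / 2))\<^sup>2 * B) = sqrt ((4 * L)\<^sup>2 * (\<rho> / \<tau>))"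
    by simp
  then have 1: "4 * L * sqrt (\<rho> / \<tau>) = c\<^sup>2 * D powr ((4 * \<theta> - 1) / 2) * B powr (1 / 2)"
    unfolding real_sqrt_mult real_sqrt_abs using pos B by (simp add: powr_half_sqrt abs_mult)
  have 2: "sqrt (m k) = D powr (1 / 2) * B powr ((1 - e) / (2 * (4 * \<theta> - 1)))"
    using pos B by (simp add: m_def B_def[symmetric] e_def powr_half_sqrt[symmetric] powr_mult powr_powr mult.commute)
  have "(4 * \<theta>) powr (- real (Suc k)) = e / (4 * \<theta>)"
    using \<theta> by (simp add: e_def powr_diff powr_minus_divide)
  then have 3: "m (Suc k) powr (2 * \<theta>) = D powr (2 * \<theta>) * B powr ((1 - e / (4 * \<theta>)) / (4 * \<theta> - 1) * (2 * \<theta>))"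
    using pos B by (simp add: m_def B_def[symmetric] powr_mult powr_powr)
  \<comment> \<open>Writing \<open>p k\<close> for the exponent of \<open>C / \<tau>\<close> in
    \<open>m k\<close>, this says \<open>1 / 2 + p k / 2 = 2 * \<theta> * p (k + 1)\<close>.\<close>
  have ex: "1 / 2 + (1 - e) / (2 * (4 * \<theta> - 1)) = (1 - e / (4 * \<theta>)) / (4 * \<theta> - 1) * (2 * \<theta>)"
    using \<theta> by (simp add: field_simps)
  have "4 * L * sqrt (\<rho> / \<tau>) * sqrt (m k)
      = c\<^sup>2 * (D powr ((4 * \<theta> - 1) / 2) * D powr (1 / 2)) * (B powr (1 / 2) * B powr ((1 - e) / (2 * (4 * \<theta> - 1))))"
    unfolding 1 2 by (simp only: mult_ac)
  also have "\<dots> = c\<^sup>2 * D powr (2 * \<theta>) * B powr ((1 - e / (4 * \<theta>)) / (4 * \<theta> - 1) * (2 * \<theta>))"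
    unfolding powr_add[symmetric] ex by (simp add: add_divide_distrib[symmetric])
  finally show ?thesis unfolding 3 by (simp only: mult_ac)
qed


context restart_scheme
begin

lemma borel_measurable_outer: "k \<le> N \<Longrightarrow> outer k \<in> borel_measurable M"
  by (rule measurable_compose[OF measurable_outer measurable_SX_borel])

text \<open>The two bounds feed each other: the moment at \<open>k\<close> controls the gradient at
  \<open>Suc k\<close>, and the Lojasiewicz inequality turns that into the moment at
  \<open>Suc k\<close>.\<close>

lemma nn_integral_outer_le:
  assumes c: "c > 0" and \<theta>: "\<theta> \<ge> 1/2"
    and KL: "\<And>y. y \<in> V \<Longrightarrow> norm (gradient env y) \<ge> c * gap y powr \<theta>"
    and V: "\<And>k. k \<le> N \<Longrightarrow> AE \<omega> in M. outer k \<omega> \<in> V"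
    and D: "gap x0 > 0"
    and C: "C = 16 * c powr (- 4) * gap x0 powr (1 - 4 * \<theta>) * \<rho> * L\<^sup>2"
  defines "m \<equiv> \<lambda>k::nat. gap x0 * (C / (real t + 1)) powr ((1 - (4 * \<theta>) powr (- real k)) / (4 * \<theta> - 1))"
  shows "k \<le> N \<Longrightarrow> (\<integral>\<^sup>+\<omega>. ennreal (gap (outer k \<omega>) powr (2 * \<theta>)) \<partial>M) \<le> ennreal (m k powr (2 * \<theta>))"
    and "k < N \<Longrightarrow> (\<integral>\<^sup>+\<omega>. ennreal ((norm (gradient env (outer (Suc k) \<omega>)))\<^sup>2) \<partial>M)
      \<le> ennreal (c\<^sup>2 * m (Suc k) powr (2 * \<theta>))"
proof -
  have C0: "C > 0" using c D rho L by (simp add: C)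
  have m_pos: "m k > 0" for k using D C0 by (simp add: m_def add_nonneg_pos)
  have grad: "(\<integral>\<^sup>+\<omega>. ennreal ((norm (gradient env (outer (Suc k) \<omega>)))\<^sup>2) \<partial>M)
      \<le> ennreal (c\<^sup>2 * m (Suc k) powr (2 * \<theta>))"
    if k: "k < N" and IH: "(\<integral>\<^sup>+\<omega>. ennreal (gap (outer k \<omega>) powr (2 * \<theta>)) \<partial>M) \<le> ennreal (m k powr (2 * \<theta>))" for k
  proof -
    have [measurable]: "outer k \<in> borel_measurable M" using k by (intro borel_measurable_outer) simp
    \<comment> \<open>The exponent \<open>1 / (4 * \<theta>)\<close> is at most \<open>1\<close>, so
      the moment comparison passes from the power \<open>2 * \<theta>\<close> down to the square
      root.\<close>
    have "sqrt u = (u powr (2 * \<theta>)) powr (1 / (4 * \<theta>))" if "u \<ge> 0" for u :: real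
      using that \<theta> by (simp add: powr_powr powr_half_sqrt)
    then have "(\<integral>\<^sup>+\<omega>. ennreal (sqrt (gap (outer k \<omega>))) \<partial>M)
        = (\<integral>\<^sup>+\<omega>. ennreal ((gap (outer k \<omega>) powr (2 * \<theta>)) powr (1 / (4 * \<theta>))) \<partial>M)"
      using gap_nonneg by simp
    also have "\<dots> \<le> ennreal ((m k powr (2 * \<theta>)) powr (1 / (4 * \<theta>)))"
      using \<theta> m_pos[of k] by (intro nn_integral_powr_le IH) auto
    also have "(m k powr (2 * \<theta>)) powr (1 / (4 * \<theta>)) = sqrt (m k)"
      using \<theta> m_pos[of k] by (simp add: powr_powr powr_half_sqrt)
    finally have "(\<integral>\<^sup>+\<omega>. ennreal (sqrt (gap (outer k \<omega>))) \<partial>M) \<le> ennreal (sqrt (m k))" .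
    then have "(\<integral>\<^sup>+\<omega>. ennreal ((norm (gradient env (outer (Suc k) \<omega>)))\<^sup>2) \<partial>M)
        \<le> ennreal (4 * L * sqrt (\<rho> / (real t + 1))) * ennreal (sqrt (m k))"
      by (intro order_trans[OF nn_integral_gradient_outer_Suc_le[OF k]] mult_left_mono) auto
    also have "\<dots> = ennreal (4 * L * sqrt (\<rho> / (real t + 1)) * sqrt (m k))"
      using L rho m_pos[of k] by (intro ennreal_mult[symmetric]) auto
    also have "4 * L * sqrt (\<rho> / (real t + 1)) * sqrt (m k) = c\<^sup>2 * m (Suc k) powr (2 * \<theta>)"
      unfolding m_def using c D rho L \<theta> C by (intro restart_rate_recursion) auto
    finally show ?thesis .
  qed
  have gap: "(\<integral>\<^sup>+\<omega>. ennreal (gap (outer k \<omega>) powr (2 * \<theta>)) \<partial>M) \<le> ennreal (m k powr (2 * \<theta>))"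
    if "k \<le> N" for k
    using that
  proof (induction k)
    case 0
    have "m 0 = gap x0" using C0 \<theta> by (simp add: m_def add_nonneg_pos)
    then show ?case by (simp add: outer_0 emeasure_space_1)
  next
    case (Suc k)
    have [measurable]: "outer (Suc k) \<in> borel_measurable M"
      using Suc.prems by (rule borel_measurable_outer)
    have "ennreal (c\<^sup>2) * (\<integral>\<^sup>+\<omega>. ennreal (gap (outer (Suc k) \<omega>) powr (2 * \<theta>)) \<partial>M)
        = (\<integral>\<^sup>+\<omega>. ennreal (c\<^sup>2 * gap (outer (Suc k) \<omega>) powr (2 * \<theta>)) \<partial>M)"
      by (subst nn_integral_cmult[symmetric]) (auto simp: ennreal_mult)
    also have "\<dots> \<le> (\<integral>\<^sup>+\<omega>. ennreal ((norm (gradient env (outer (Suc k) \<omega>)))\<^sup>2) \<partial>M)"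
    proof (rule nn_integral_mono_AE)
      show "AE \<omega> in M. ennreal (c\<^sup>2 * gap (outer (Suc k) \<omega>) powr (2 * \<theta>))
          \<le> ennreal ((norm (gradient env (outer (Suc k) \<omega>)))\<^sup>2)"
        using V[OF Suc.prems]
      proof eventually_elim
        case (elim \<omega>)
        have "(c * gap (outer (Suc k) \<omega>) powr \<theta>)\<^sup>2 \<le> (norm (gradient env (outer (Suc k) \<omega>)))\<^sup>2"
          using KL[OF elim] c by (intro power_mono) auto
        moreover have "(gap (outer (Suc k) \<omega>) powr \<theta>)\<^sup>2 = gap (outer (Suc k) \<omega>) powr (2 * \<theta>)"
          by (simp add: power2_eq_square powr_add[symmetric])
        ultimately show ?case
          by (intro ennreal_leI) (simp add: power_mult_distrib)
      qed
    qed
    also have "\<dots> \<le> ennreal (c\<^sup>2 * m (Suc k) powr (2 * \<theta>))"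
      using Suc by (intro grad Suc.IH) auto
    also have "\<dots> = ennreal (c\<^sup>2) * ennreal (m (Suc k) powr (2 * \<theta>))"
      by (rule ennreal_mult) auto
    finally show ?case
      using c by (subst (asm) ennreal_mult_le_mult_iff) auto
  qed
  show "k \<le> N \<Longrightarrow> (\<integral>\<^sup>+\<omega>. ennreal (gap (outer k \<omega>) powr (2 * \<theta>)) \<partial>M) \<le> ennreal (m k powr (2 * \<theta>))"
    by (rule gap)
  show "k < N \<Longrightarrow> (\<integral>\<^sup>+\<omega>. ennreal ((norm (gradient env (outer (Suc k) \<omega>)))\<^sup>2) \<partial>M)
      \<le> ennreal (c\<^sup>2 * m (Suc k) powr (2 * \<theta>))"
    by (intro grad gap) auto
qed


text \<open>The mean is controlled by the moment of order \<open>2 * \<theta> \<ge> 1\<close>, and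
  finite \<open>nn_integral\<close> values supply integrability. The majorant \<open>b\<close> may
  replace \<open>C / (t + 1)\<close> because the exponent is nonnegative; it will absorb the
  rounding of \<open>t\<close>.\<close>

lemma expectation_outer_le:
  assumes c: "c > 0" and \<theta>: "\<theta> \<ge> 1/2"
    and KL: "\<And>y. y \<in> V \<Longrightarrow> norm (gradient env y) \<ge> c * gap y powr \<theta>"
    and V: "\<And>k. k \<le> N \<Longrightarrow> AE \<omega> in M. outer k \<omega> \<in> V"
    and D: "gap x0 > 0"
    and C: "C = 16 * c powr (- 4) * gap x0 powr (1 - 4 * \<theta>) * \<rho> * L\<^sup>2"
    and N: "N \<ge> 1" and b: "C / (real t + 1) \<le> b"
  defines "m \<equiv> gap x0 * b powr ((1 - (4 * \<theta>) powr (- real N)) / (4 * \<theta> - 1))"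
  shows "integrable M (\<lambda>\<omega>. env (outer N \<omega>))"
    and "integrable M (\<lambda>\<omega>. (norm (gradient env (outer N \<omega>)))\<^sup>2)"
    and "(\<integral>\<omega>. env (outer N \<omega>) \<partial>M) - fstar \<le> m"
    and "(\<integral>\<omega>. (norm (gradient env (outer N \<omega>)))\<^sup>2 \<partial>M) \<le> c\<^sup>2 * m powr (2 * \<theta>)"
proof -
  define m' where "m' = gap x0 * (C / (real t + 1)) powr ((1 - (4 * \<theta>) powr (- real N)) / (4 * \<theta> - 1))"
  have C0: "C > 0" using c D rho L by (simp add: C)
  have "(4 * \<theta>) powr (- real N) \<le> (4 * \<theta>) powr 0"
    using \<theta> by (intro powr_mono) auto
  then have "(4 * \<theta>) powr (- real N) \<le> 1" using \<theta> by simp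
  then have mm: "m' \<le> m"
    unfolding m'_def m_def using D \<theta> C0 b by (intro mult_left_mono powr_mono2) auto
  have m'0: "m' > 0" using D C0 by (simp add: m'_def add_nonneg_pos)
  have [measurable]: "outer N \<in> borel_measurable M" by (rule borel_measurable_outer) simp
  note bounds = nn_integral_outer_le[OF c \<theta> KL V D C]
  have "gap u = (gap u powr (2 * \<theta>)) powr (1 / (2 * \<theta>))" for u
    using gap_nonneg[of u] \<theta> by (simp add: powr_powr)
  then have "(\<integral>\<^sup>+\<omega>. ennreal (gap (outer N \<omega>)) \<partial>M)
      = (\<integral>\<^sup>+\<omega>. ennreal ((gap (outer N \<omega>) powr (2 * \<theta>)) powr (1 / (2 * \<theta>))) \<partial>M)"
    by simp
  also have "\<dots> \<le> ennreal ((m' powr (2 * \<theta>)) powr (1 / (2 * \<theta>)))"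
    using \<theta> m'0 bounds(1)[of N, folded m'_def]
    by (intro nn_integral_powr_le[where u = "\<lambda>\<omega>. gap (outer N \<omega>) powr (2 * \<theta>)"]) auto
  also have "(m' powr (2 * \<theta>)) powr (1 / (2 * \<theta>)) = m'"
    using \<theta> m'0 by (simp add: powr_powr)
  finally have gap: "(\<integral>\<^sup>+\<omega>. ennreal (gap (outer N \<omega>)) \<partial>M) \<le> ennreal m'" .
  have grad: "(\<integral>\<^sup>+\<omega>. ennreal ((norm (gradient env (outer N \<omega>)))\<^sup>2) \<partial>M) \<le> ennreal (c\<^sup>2 * m' powr (2 * \<theta>))"
    using bounds(2)[of "N - 1"] N by (simp add: m'_def)
  have int_gap: "integrable M (\<lambda>\<omega>. gap (outer N \<omega>))"
    using gap gap_nonneg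
    by (intro integrableI_nonneg) (auto intro: le_less_trans)
  from Bochner_Integration.integrable_add[OF this integrable_const[of fstar]]
  show int: "integrable M (\<lambda>\<omega>. env (outer N \<omega>))" by simp
  have "ennreal (\<integral>\<omega>. gap (outer N \<omega>) \<partial>M) \<le> ennreal m'"
    using gap gap_nonneg by (subst nn_integral_eq_integral[symmetric]) (auto intro!: int_gap)
  then have "(\<integral>\<omega>. gap (outer N \<omega>) \<partial>M) \<le> m'"
    using m'0 by (simp add: ennreal_le_iff)
  then show "(\<integral>\<omega>. env (outer N \<omega>) \<partial>M) - fstar \<le> m"
    using mm int by (simp add: prob_space)
  show int_grad: "integrable M (\<lambda>\<omega>. (norm (gradient env (outer N \<omega>)))\<^sup>2)"
    using grad by (intro integrableI_nonneg) (auto intro: le_less_trans)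
  have "ennreal (\<integral>\<omega>. (norm (gradient env (outer N \<omega>)))\<^sup>2 \<partial>M) \<le> ennreal (c\<^sup>2 * m' powr (2 * \<theta>))"
    using grad by (subst nn_integral_eq_integral[symmetric]) (auto intro!: int_grad)
  then have "(\<integral>\<omega>. (norm (gradient env (outer N \<omega>)))\<^sup>2 \<partial>M) \<le> c\<^sup>2 * m' powr (2 * \<theta>)"
    by (simp add: ennreal_le_iff)
  also have "\<dots> \<le> c\<^sup>2 * m powr (2 * \<theta>)"
    using mm m'0 \<theta> by (intro mult_left_mono powr_mono2) auto
  finally show "(\<integral>\<omega>. (norm (gradient env (outer N \<omega>)))\<^sup>2 \<partial>M) \<le> c\<^sup>2 * m powr (2 * \<theta>)" .
qed

end

section \<open>Asymptotics of the optimal number of restarts\<close>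

text \<open>With \<open>a = ln (4 * \<theta>)\<close> and \<open>l = ln (T / C)\<close> one has
  \<open>restart_bound \<Delta> C \<theta> T x = \<Delta> * exp (- log_gain a l x / (4 * \<theta> - 1))\<close>, also at \<open>x = 0\<close>.\<close>

definition log_gain :: "real \<Rightarrow> real \<Rightarrow> real \<Rightarrow> real" where
  "log_gain a l x = (1 - exp (- a * x)) * (l - ln x)"

definition log_gain_maximizer :: "real \<Rightarrow> real \<Rightarrow> real \<Rightarrow> bool" where
  "log_gain_maximizer a l x \<longleftrightarrow> x \<ge> 0 \<and> (\<forall>y\<ge>0. log_gain a l y \<le> log_gain a l x)"

lemma log_gain_0 [simp]: "log_gain a l 0 = 0"
  by (simp add: log_gain_def)

text \<open>Beyond \<open>exp l\<close> the second factor is nonpositive, so a compact interval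
  suffices. Continuity at \<open>0\<close> holds because \<open>1 - exp (- a * x)\<close> vanishes
  faster than \<open>ln x\<close> blows up.\<close>

lemma log_gain_maximizer_exists:
  assumes a: "a > 0"
  shows "\<exists>x. log_gain_maximizer a l x"
proof -
  have "continuous_on {0..exp l} (log_gain a l)"
    unfolding continuous_on_def
  proof
    fix x assume x: "x \<in> {0..exp l}"
    show "(log_gain a l \<longlongrightarrow> log_gain a l x) (at x within {0..exp l})"
    proof (cases "x = 0")
      case True
      have "((\<lambda>x. (1 - exp (- a * x)) * (l - ln x)) \<longlongrightarrow> 0) (at_right 0)"
        using a by real_asymp
      then show ?thesis
        using True by (simp add: at_within_Icc_at_right log_gain_def[abs_def])
    next
      case False
      with x show ?thesis
        unfolding log_gain_def by (intro tendsto_intros) auto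
    qed
  qed
  then obtain x where x: "x \<in> {0..exp l}" "\<And>y. y \<in> {0..exp l} \<Longrightarrow> log_gain a l y \<le> log_gain a l x"
    using continuous_attains_sup[of "{0..exp l}" "log_gain a l"] by auto
  have "log_gain a l y \<le> log_gain a l x" if "y \<ge> 0" for y
  proof (cases "y \<le> exp l")
    case False
    then have "l \<le> ln y" by (metis exp_gt_zero ln_exp ln_le_cancel_iff less_le_trans not_le order_less_imp_le)
    then have "log_gain a l y \<le> 0"
      using a that by (auto simp: log_gain_def mult_le_0_iff)
    also have "0 \<le> log_gain a l x" using x(2)[of 0] by simp
    finally show ?thesis .
  qed (use x that in auto)
  then show ?thesis using x unfolding log_gain_maximizer_def by auto
qed

lemma log_gain_maximizer_first_order:
  assumes a: "a > 0" and x: "log_gain_maximizer a l x"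
  shows "x > 0" "ln x < l" "a * x * (l - ln x) * exp (- a * x) = 1 - exp (- a * x)"
proof -
  \<comment> \<open>At this point \<open>l - ln x\<close> equals \<open>1\<close>, so the maximum is
    positive. That excludes \<open>x = 0\<close> and \<open>ln x \<ge> l\<close>, and the maximizer
    is interior.\<close>
  have "log_gain a l (exp (l - 1)) = 1 - exp (- a * exp (l - 1))"
    by (simp add: log_gain_def)
  also have "\<dots> > 0" using a by simp
  finally have "0 < log_gain a l (exp (l - 1))" .
  also have "\<dots> \<le> log_gain a l x"
    using x by (simp add: log_gain_maximizer_def)
  finally have pos: "0 < log_gain a l x" .
  show x0: "x > 0"
    using x pos unfolding log_gain_maximizer_def by (cases "x = 0") auto
  then have "1 - exp (- a * x) > 0" using a by simp
  with pos have "0 < l - ln x"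
    unfolding log_gain_def by (rule zero_less_mult_pos)
  then show "ln x < l" by simp
  have "DERIV (log_gain a l) x :> exp (- a * x) * a * (l - ln x) + (1 - exp (- a * x)) * (- (1 / x))"
    unfolding log_gain_def[abs_def]
    by (rule derivative_eq_intros refl | use x0 in simp)+
  moreover have "\<forall>y. \<bar>x - y\<bar> < x \<longrightarrow> log_gain a l y \<le> log_gain a l x"
    using x by (auto simp: log_gain_maximizer_def)
  ultimately have "exp (- a * x) * a * (l - ln x) + (1 - exp (- a * x)) * (- (1 / x)) = 0"
    using DERIV_local_max[OF _ x0] by blast
  then show "a * x * (l - ln x) * exp (- a * x) = 1 - exp (- a * x)"
    using x0 by (simp add: field_simps)
qed

text \<open>The lower bound compares the maximizer with the point \<open>2 * ln l / a\<close>; the upper bound comes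
  from the first-order condition.\<close>

lemma log_gain_maximizer_bounds:
  assumes a: "a > 0"
  shows "\<forall>\<^sub>F l in at_top. \<forall>x. log_gain_maximizer a l x \<longrightarrow>
      (ln l - ln (2 * ln (ln l))) / a \<le> x
    \<and> x \<le> (ln l + 2 * ln (ln l) + ln a - ln (1 - exp (- a))) / a"
proof -
  \<comment> \<open>At \<open>x = 2 * ln l / a\<close> the exponential is
    \<open>1 / l\<^sup>2\<close>, so the loss against \<open>l\<close> is \<open>ln (ln l)\<close>
    up to a bounded term; the factor \<open>2\<close> leaves room for it.\<close>
  have "\<forall>\<^sub>F l in at_top. l - 2 * ln (ln l) \<le> (1 - exp (- 2 * ln l)) * (l - ln (2 * ln l / a))"
    using a by real_asymp
  moreover have "\<forall>\<^sub>F l in at_top. (1 - exp (- a)) * l + a < l - 2 * ln (ln l)"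
    by real_asymp
  moreover have "\<forall>\<^sub>F l in at_top. 0 < ln (ln (l::real))" "\<forall>\<^sub>F l in at_top. 1 < (l::real)"
    "\<forall>\<^sub>F l in at_top. 0 < ln (l::real)"
    by real_asymp+
  ultimately show ?thesis
  proof eventually_elim
    case (elim l)
    show ?case
    proof (intro allI impI)
      fix x assume x: "log_gain_maximizer a l x"
      note fo = log_gain_maximizer_first_order[OF a x]
      have "l - 2 * ln (ln l) \<le> log_gain a l (2 * ln l / a)"
        using elim(1) a by (simp add: log_gain_def)
      also have "\<dots> \<le> log_gain a l x"
        using x a elim by (auto simp: log_gain_maximizer_def)
      finally have gain: "l - 2 * ln (ln l) \<le> log_gain a l x" .
      \<comment> \<open>Below \<open>1\<close> the first factor would stay under
        \<open>1 - exp (- a)\<close>, a loss of order \<open>l\<close>. From here on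
        \<open>ln x \<ge> 0\<close>.\<close>
      have x1: "x \<ge> 1"
      proof (rule ccontr)
        assume "\<not> x \<ge> 1"
        then have "x < 1" by simp
        have "1 - exp (- a * x) \<le> a * x" using exp_ge_add_one_self[of "- a * x"] by simp
        moreover have "- ln x \<le> 1 / x - 1"
          using ln_le_minus_one[of "1 / x"] fo(1) by (simp add: ln_div)
        moreover have "0 \<le> - ln x" using fo(1) \<open>x < 1\<close> by simp
        ultimately have "(1 - exp (- a * x)) * (- ln x) \<le> (a * x) * (1 / x - 1)"
          using a fo(1) by (intro mult_mono) auto
        also have "\<dots> \<le> a" using a fo(1) by (simp add: field_simps)
        finally have "(1 - exp (- a * x)) * (- ln x) \<le> a" .
        moreover have "(1 - exp (- a * x)) * l \<le> (1 - exp (- a)) * l"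
          using a \<open>x < 1\<close> fo(1) elim by (intro mult_right_mono) auto
        ultimately have "log_gain a l x \<le> (1 - exp (- a)) * l + a"
          unfolding log_gain_def by (simp add: algebra_simps)
        with gain elim(2) show False by linarith
      qed
      have e: "exp (- a * x) < 1" using a fo(1) by simp
      \<comment> \<open>Bounding the first factor by \<open>1\<close> yields an upper bound for
        \<open>ln x\<close>; bounding the second by \<open>l\<close> yields the lower bound for
        \<open>x\<close>.\<close>
      have "log_gain a l x \<le> 1 * (l - ln x)"
        unfolding log_gain_def using fo(2) by (intro mult_right_mono) auto
      with gain have lnx: "ln x \<le> 2 * ln (ln l)" by simp
      have "log_gain a l x \<le> (1 - exp (- a * x)) * l"
        unfolding log_gain_def using e x1 by (intro mult_left_mono) auto
      with gain have "exp (- a * x) * l \<le> 2 * ln (ln l)" by (simp add: algebra_simps)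
      then have "ln (exp (- a * x) * l) \<le> ln (2 * ln (ln l))"
        using elim by (intro ln_mono) auto
      then have "ln l - ln (2 * ln (ln l)) \<le> a * x"
        using elim by (simp add: ln_mult)
      moreover have "a * x \<le> ln l + 2 * ln (ln l) + ln a - ln (1 - exp (- a))"
      proof -
        have "1 - exp (- a) \<le> 1 - exp (- a * x)" using a x1 by simp
        also have "\<dots> = a * x * (l - ln x) * exp (- a * x)" using fo(3) by simp
        also have "\<dots> \<le> a * x * l * exp (- a * x)"
          using a fo(1) x1 by (intro mult_right_mono mult_left_mono) auto
        finally have "ln (1 - exp (- a)) \<le> ln (a * x * l * exp (- a * x))"
          using a by (intro ln_mono) auto
        also have "\<dots> = ln a + ln x + ln l - a * x"
          using a fo(1) elim by (simp add: ln_mult)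
        finally show ?thesis using lnx by simp
      qed
      ultimately show "(ln l - ln (2 * ln (ln l))) / a \<le> x
          \<and> x \<le> (ln l + 2 * ln (ln l) + ln a - ln (1 - exp (- a))) / a"
        using a by (simp add: pos_divide_le_eq pos_le_divide_eq mult.commute)
    qed
  qed
qed

lemma log_gain_maximizer_asymp:
  assumes a: "a > 0" and l: "filterlim l at_top G"
    and x: "\<forall>\<^sub>F t in G. log_gain_maximizer a (l t) (x t)"
  shows "((\<lambda>t. x t / (ln (l t) / a)) \<longlongrightarrow> 1) G"
proof (rule tendsto_sandwich)
  note ev = eventually_conj[OF filterlim_iff[THEN iffD1, OF l, rule_format, OF log_gain_maximizer_bounds[OF a]]
      eventually_conj[OF x filterlim_at_top_dense[THEN iffD1, OF l, rule_format, of 1]]]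
  show "\<forall>\<^sub>F t in G. ((ln (l t) - ln (2 * ln (ln (l t)))) / a) / (ln (l t) / a) \<le> x t / (ln (l t) / a)"
    using ev by eventually_elim (use a in \<open>intro divide_right_mono; auto\<close>)
  show "\<forall>\<^sub>F t in G. x t / (ln (l t) / a)
      \<le> ((ln (l t) + 2 * ln (ln (l t)) + ln a - ln (1 - exp (- a))) / a) / (ln (l t) / a)"
    using ev by eventually_elim (use a in \<open>intro divide_right_mono; auto\<close>)
  have "((\<lambda>l. ((ln l - ln (2 * ln (ln l))) / a) / (ln l / a)) \<longlongrightarrow> 1) at_top"
    using a by real_asymp
  then show "((\<lambda>t. ((ln (l t) - ln (2 * ln (ln (l t)))) / a) / (ln (l t) / a)) \<longlongrightarrow> 1) G"
    by (rule filterlim_compose[OF _ l])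
  have "((\<lambda>l. ((ln l + 2 * ln (ln l) + K) / a) / (ln l / a)) \<longlongrightarrow> 1) at_top" for K
    using a by real_asymp
  from this[of "ln a - ln (1 - exp (- a))"]
  show "((\<lambda>t. ((ln (l t) + 2 * ln (ln (l t)) + ln a - ln (1 - exp (- a))) / a) / (ln (l t) / a)) \<longlongrightarrow> 1) G"
    by (intro filterlim_compose[OF _ l]) (simp add: add_diff_eq)
qed

text \<open>With \<open>n\<close> the rounded maximizer and \<open>L = ln l / a\<close>, the
  difference is \<open>ln (n / L) + exp (- a * n) * (l - ln n)\<close>. The first term vanishes
  since \<open>n\<close> is asymptotic to \<open>L\<close>, the second by the first-order
  condition.\<close>

lemma log_gain_ceiling_asymp:
  assumes a: "a > 0" and l: "filterlim l at_top G"
    and x: "\<forall>\<^sub>F t in G. log_gain_maximizer a (l t) (x t)"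
  shows "((\<lambda>t. (l t - ln (ln (l t) / a)) - log_gain a (l t) (real (nat \<lceil>x t\<rceil>))) \<longlongrightarrow> 0) G"
    and "((\<lambda>t. real (nat \<lceil>x t\<rceil>) / (ln (l t) / a)) \<longlongrightarrow> 1) G"
    and "filterlim x at_top G"
proof -
  let ?n = "\<lambda>t. real (nat \<lceil>x t\<rceil>)" and ?L = "\<lambda>t. ln (l t) / a"
  note lim = log_gain_maximizer_asymp[OF a l x]
  have L: "filterlim ?L at_top G"
  proof -
    have "filterlim (\<lambda>l. ln l / a) at_top at_top" using a by real_asymp
    then show ?thesis by (rule filterlim_compose[OF _ l])
  qed
  have Lpos: "\<forall>\<^sub>F t in G. ?L t > 0"
    using L by (simp add: filterlim_at_top_dense)
  have "filterlim (\<lambda>t. x t / ?L t * ?L t) at_top G"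
    by (rule filterlim_tendsto_pos_mult_at_top[OF lim _ L]) simp
  then show x_top: "filterlim x at_top G"
    by (rule filterlim_cong[THEN iffD1, OF refl refl, rotated]) (use Lpos in eventually_elim, use a in auto)
  have xpos: "\<forall>\<^sub>F t in G. 1 \<le> x t" using x_top by (simp add: filterlim_at_top)
  show nlim: "((\<lambda>t. ?n t / ?L t) \<longlongrightarrow> 1) G"
  proof (rule tendsto_sandwich)
    show "\<forall>\<^sub>F t in G. x t / ?L t \<le> ?n t / ?L t"
      using Lpos xpos by eventually_elim (intro divide_right_mono; linarith)
    show "\<forall>\<^sub>F t in G. ?n t / ?L t \<le> x t / ?L t + inverse (?L t)"
      using Lpos xpos
    proof eventually_elim
      case (elim t)
      have "?n t \<le> x t + 1" using elim by linarith
      then have "?n t / ?L t \<le> (x t + 1) / ?L t"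
        using elim by (intro divide_right_mono) auto
      then show ?case by (simp only: add_divide_distrib inverse_eq_divide)
    qed
    show "((\<lambda>t. x t / ?L t + inverse (?L t)) \<longlongrightarrow> 1) G"
      using tendsto_add[OF lim tendsto_inverse_0_at_top[OF L]] by simp
  qed (rule lim)
  have "((\<lambda>t. exp (- a * ?n t) * (l t - ln (?n t))) \<longlongrightarrow> 0) G"
  proof (rule tendsto_sandwich)
    have "\<forall>\<^sub>F l in at_top. 2 * (ln l / a) \<le> exp l"
      using a by real_asymp
    then have big: "\<forall>\<^sub>F t in G. 2 * ?L t \<le> exp (l t)"
      by (rule filterlim_iff[THEN iffD1, OF l, rule_format])
    have "\<forall>\<^sub>F t in G. ?n t / ?L t < 2"
      using nlim by (rule order_tendstoD) simp
    with big have nn: "\<forall>\<^sub>F t in G. ln (?n t) \<le> l t"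
      using Lpos xpos
    proof eventually_elim
      case (elim t)
      have "?n t < 2 * ?L t"
        using elim(2,3) by (simp only: pos_divide_less_eq)
      with elim(1) have "?n t \<le> exp (l t)" by simp
      moreover have "?n t > 0" using elim by linarith
      ultimately show ?case by (metis ln_exp ln_mono)
    qed
    then show "\<forall>\<^sub>F t in G. 0 \<le> exp (- a * ?n t) * (l t - ln (?n t))"
      by eventually_elim simp
    show "\<forall>\<^sub>F t in G. exp (- a * ?n t) * (l t - ln (?n t)) \<le> inverse a * inverse (x t)"
      using nn xpos x
    proof eventually_elim
      case (elim t)
      note fo = log_gain_maximizer_first_order[OF a elim(3)]
      have ge: "x t \<le> ?n t" using elim by linarith
      \<comment> \<open>Rounding up shrinks both factors, so the first-order condition at the
        unrounded point still bounds the product, by \<open>1 / (a * x t)\<close>.\<close>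
      have "exp (- a * ?n t) * (l t - ln (?n t)) \<le> exp (- a * x t) * (l t - ln (x t))"
        using ge elim a fo by (intro mult_mono) auto
      also have "\<dots> = (1 - exp (- a * x t)) / (a * x t)"
        using fo a by (simp add: field_simps)
      also have "\<dots> \<le> 1 / (a * x t)"
        using fo a by (intro divide_right_mono) auto
      finally show ?case by (simp add: field_simps)
    qed
    show "((\<lambda>t. inverse a * inverse (x t)) \<longlongrightarrow> 0) G"
      using tendsto_mult[OF tendsto_const tendsto_inverse_0_at_top[OF x_top]] by simp
  qed simp
  moreover have "((\<lambda>t. ln (?n t / ?L t)) \<longlongrightarrow> ln 1) G"
    using nlim by (rule tendsto_ln) simp
  ultimately have "((\<lambda>t. ln (?n t / ?L t) + exp (- a * ?n t) * (l t - ln (?n t))) \<longlongrightarrow> ln 1 + 0) G"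
    by (intro tendsto_add)
  then have "((\<lambda>t. ln (?n t / ?L t) + exp (- a * ?n t) * (l t - ln (?n t))) \<longlongrightarrow> 0) G" by simp
  moreover have "\<forall>\<^sub>F t in G. ln (?n t / ?L t) + exp (- a * ?n t) * (l t - ln (?n t))
      = (l t - ln (?L t)) - log_gain a (l t) (?n t)"
    using Lpos xpos
  proof eventually_elim
    case (elim t)
    then have n: "?n t > 0" by linarith
    show ?case
      unfolding log_gain_def ln_divide_pos[OF n elim(1)] by (simp add: algebra_simps)
  qed
  ultimately show "((\<lambda>t. (l t - ln (?L t)) - log_gain a (l t) (?n t)) \<longlongrightarrow> 0) G"
    by (rule Lim_transform_eventually)
qed


section \<open>From the logarithmic gain back to the restart bound\<close>

lemma powr_gain_eq_exp:
  assumes "C > 0" "T > 0" "x > 0" "\<theta> \<ge> 1/2"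
  shows "(C * x / T) powr ((1 - (4 * \<theta>) powr (- x)) / (4 * \<theta> - 1))
    = exp (- (log_gain (ln (4 * \<theta>)) (ln (T / C)) x / (4 * \<theta> - 1)))"
proof -
  have 1: "ln (C * x / T) = - (ln (T / C) - ln x)"
    using assms by (simp add: ln_mult ln_div)
  have 2: "(4 * \<theta>) powr (- x) = exp (- ln (4 * \<theta>) * x)"
    using assms by (simp add: powr_def mult.commute)
  have "C * x / T \<noteq> 0" using assms by simp
  then show ?thesis
    unfolding powr_def[of "C * x / T"] 1 2 log_gain_def by (simp del: minus_diff_eq)
qed

lemma restart_bound_eq_exp:
  assumes "C > 0" "T > 0" "x \<ge> 0" "\<theta> \<ge> 1/2"
  shows "restart_bound \<Delta> C \<theta> T x
    = \<Delta> * exp (- (log_gain (ln (4 * \<theta>)) (ln (real T / C)) x / (4 * \<theta> - 1)))"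
  using powr_gain_eq_exp[of C "real T" x \<theta>] assms
  by (cases "x = 0") (auto simp: restart_bound_def)

text \<open>The bound is a decreasing function of the gain, so minimizers and maximizers coincide.
  Existence of one makes the choice behind \<open>arg_min_on\<close> a genuine minimizer.\<close>

lemma log_gain_maximizer_opt_outer:
  assumes "\<Delta> > 0" "C > 0" "T > 0" and \<theta>: "\<theta> \<ge> 1/2"
  shows "log_gain_maximizer (ln (4 * \<theta>)) (ln (real T / C)) (opt_outer \<Delta> C \<theta> T)"
proof -
  have "ln (4 * \<theta>) > 0" using \<theta> by simp
  then obtain w where w: "log_gain_maximizer (ln (4 * \<theta>)) (ln (real T / C)) w"
    using log_gain_maximizer_exists by blast
  have *: "is_arg_min (restart_bound \<Delta> C \<theta> T) (\<lambda>x. x \<in> {0..}) x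
      \<longleftrightarrow> log_gain_maximizer (ln (4 * \<theta>)) (ln (real T / C)) x" for x
    using assms by (auto simp: is_arg_min_linorder log_gain_maximizer_def restart_bound_eq_exp divide_le_cancel)
  show ?thesis
    unfolding opt_outer_def arg_min_on_def arg_min_def *
    using w by (rule someI)
qed

text \<open>Specializes the gain estimates to \<open>l = ln (T / C)\<close>. The inequality
  \<open>N T \<le> T\<close> ensures at least one inner iteration per restart.\<close>

lemma opt_outer_asymp:
  assumes "\<Delta> > 0" "C > 0" and \<theta>: "\<theta> \<ge> 1/2"
  defines "N \<equiv> \<lambda>T. nat \<lceil>opt_outer \<Delta> C \<theta> T\<rceil>"
  shows "opt_outer \<Delta> C \<theta> \<sim>[at_top] (\<lambda>T. ln (ln (real T / C)) / ln (4 * \<theta>))"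
    and "\<forall>\<^sub>F T in at_top. 1 \<le> N T \<and> N T \<le> T"
    and "(\<lambda>T. (C * N T / T) powr ((1 - (4 * \<theta>) powr (- real (N T))) / (4 * \<theta> - 1)))
      \<sim>[at_top] (\<lambda>T. (C * ln (ln (real T / C)) / (real T * ln (4 * \<theta>))) powr (1 / (4 * \<theta> - 1)))"
proof -
  define a where "a = ln (4 * \<theta>)"
  define l where "l = (\<lambda>T::nat. ln (real T / C))"
  let ?n = "\<lambda>T. real (N T)"
  have a: "a > 0" using \<theta> by (simp add: a_def)
  have l: "filterlim l at_top at_top"
    unfolding l_def using \<open>C > 0\<close> by real_asymp
  have T0: "\<forall>\<^sub>F T::nat in at_top. T > 0" by (rule eventually_gt_at_top)
  then have max: "\<forall>\<^sub>F T in at_top. log_gain_maximizer a (l T) (opt_outer \<Delta> C \<theta> T)"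
    unfolding a_def l_def
    by eventually_elim (use log_gain_maximizer_opt_outer assms in blast)
  have N: "nat \<lceil>opt_outer \<Delta> C \<theta> T\<rceil> = N T" for T
    by (simp add: N_def)
  note lim = log_gain_maximizer_asymp[OF a l max] log_gain_ceiling_asymp[OF a l max, unfolded N]
  have L: "filterlim (\<lambda>T. ln (l T) / a) at_top at_top"
    unfolding l_def using a \<open>C > 0\<close> by real_asymp
  then have Lpos: "\<forall>\<^sub>F T in at_top. ln (l T) / a > 0"
    by (simp add: filterlim_at_top_dense)
  show "opt_outer \<Delta> C \<theta> \<sim>[at_top] (\<lambda>T. ln (ln (real T / C)) / ln (4 * \<theta>))"
    using lim(1) by (intro asymp_equivI') (simp add: a_def l_def)
  have N1: "\<forall>\<^sub>F T in at_top. 1 \<le> N T"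
    using filterlim_at_top[THEN iffD1, OF lim(4), rule_format, of 1]
    by eventually_elim (simp add: N_def le_nat_iff)
  have "\<forall>\<^sub>F T in at_top. 2 * (ln (l T) / a) \<le> real T"
    unfolding l_def using a \<open>C > 0\<close> by real_asymp
  moreover have "\<forall>\<^sub>F T in at_top. ?n T / (ln (l T) / a) < 2"
    using lim(3) by (rule order_tendstoD) simp
  ultimately have "\<forall>\<^sub>F T in at_top. N T \<le> T"
    using Lpos
  proof eventually_elim
    case (elim T)
    have "?n T < 2 * (ln (l T) / a)"
      using elim(2,3) by (simp only: pos_divide_less_eq)
    with elim(1) show ?case by simp
  qed
  with N1 show "\<forall>\<^sub>F T in at_top. 1 \<le> N T \<and> N T \<le> T"
    by eventually_elim simp
  show "(\<lambda>T. (C * N T / T) powr ((1 - (4 * \<theta>) powr (- real (N T))) / (4 * \<theta> - 1)))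
      \<sim>[at_top] (\<lambda>T. (C * ln (ln (real T / C)) / (real T * ln (4 * \<theta>))) powr (1 / (4 * \<theta> - 1)))"
  proof (rule asymp_equivI')
    \<comment> \<open>The ratio of the two sides is \<open>exp (?d T / (4 * \<theta> - 1))\<close>,
      so the gains must agree in difference, not merely in ratio.\<close>
    let ?d = "\<lambda>T. (l T - ln (ln (l T) / a)) - log_gain a (l T) (?n T)"
    have "((\<lambda>T. exp (?d T / (4 * \<theta> - 1))) \<longlongrightarrow> exp (0 / (4 * \<theta> - 1))) at_top"
      using lim(2) \<theta> by (intro tendsto_intros) auto
    then have "((\<lambda>T. exp (?d T / (4 * \<theta> - 1))) \<longlongrightarrow> 1) at_top" by simp
    moreover have "\<forall>\<^sub>F T in at_top. exp (?d T / (4 * \<theta> - 1)) =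
        (C * N T / T) powr ((1 - (4 * \<theta>) powr (- real (N T))) / (4 * \<theta> - 1)) /
        (C * ln (ln (real T / C)) / (real T * ln (4 * \<theta>))) powr (1 / (4 * \<theta> - 1))"
      using Lpos N1 T0
    proof eventually_elim
      case (elim T)
      have lT: "ln (l T) > 0" using elim(1) a by (simp add: zero_less_divide_iff)
      have "C * ln (ln (real T / C)) / (real T * ln (4 * \<theta>)) = (ln (l T) / a) / (real T / C)"
        by (simp add: a_def l_def mult.commute)
      also have "\<dots> powr (1 / (4 * \<theta> - 1)) = exp (- ((l T - ln (ln (l T) / a)) / (4 * \<theta> - 1)))"
      proof -
        have "ln ((ln (l T) / a) / (real T / C)) = ln (ln (l T) / a) - l T"
          unfolding l_def using elim \<open>C > 0\<close> by (intro ln_divide_pos) (auto simp: l_def)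
        moreover have "(ln (l T) / a) / (real T / C) \<noteq> 0"
          using elim \<open>C > 0\<close> a lT by simp
        ultimately show ?thesis
          by (simp add: powr_def del: divide_divide_eq_right divide_divide_eq_left)
            (simp add: minus_divide_left)
      qed
      finally have B: "(C * ln (ln (real T / C)) / (real T * ln (4 * \<theta>))) powr (1 / (4 * \<theta> - 1))
          = exp (- ((l T - ln (ln (l T) / a)) / (4 * \<theta> - 1)))" .
      have R: "(C * N T / T) powr ((1 - (4 * \<theta>) powr (- real (N T))) / (4 * \<theta> - 1))
          = exp (- (log_gain a (l T) (?n T) / (4 * \<theta> - 1)))"
        unfolding a_def l_def using elim \<open>C > 0\<close> \<theta> by (intro powr_gain_eq_exp) auto
      show ?case
        unfolding B R exp_diff[symmetric] by (simp add: diff_divide_distrib)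
    qed
    ultimately show "((\<lambda>T. (C * N T / T) powr ((1 - (4 * \<theta>) powr (- real (N T))) / (4 * \<theta> - 1)) /
        (C * ln (ln (real T / C)) / (real T * ln (4 * \<theta>))) powr (1 / (4 * \<theta> - 1))) \<longlongrightarrow> 1) at_top"
      by (rule Lim_transform_eventually)
  qed
qed

section \<open>Rates for the rounded scheme\<close>

text \<open>Each budget \<open>T\<close> has its own probability space and random variables, since
  the iteration counts change with \<open>T\<close>. Integrability is asserted because the HOL
  integral of a non-integrable function is \<open>0\<close>.\<close>

theorem theorem4p5:
  fixes g :: "'a::euclidean_space \<Rightarrow> real"
    and f :: "'a \<Rightarrow> ereal"
    and X V :: "'a set"
    and x\<^sub>0 :: 'a
    and \<rho> c \<theta> L \<Delta>\<^sub>0 C fstar :: real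
    and F :: "'a \<Rightarrow> real"
    and P :: "'b measure"
    and G :: "'a \<Rightarrow> 'b \<Rightarrow> 'a"
    and Nstar :: "nat \<Rightarrow> real"
    and N t :: "nat \<Rightarrow> nat"
    and M :: "nat \<Rightarrow> 'w measure"
    and \<xi> :: "nat \<Rightarrow> nat \<Rightarrow> nat \<Rightarrow> 'w \<Rightarrow> 'b"
    and J :: "nat \<Rightarrow> nat \<Rightarrow> 'w \<Rightarrow> nat"
    and x :: "nat \<Rightarrow> nat \<Rightarrow> 'w \<Rightarrow> 'a"
  assumes rho: "\<rho> > 0"
    and g: "weakly_convex \<rho> g"
    and X: "X \<noteq> {}" "closed X" "convex X"
    and f: "f = (\<lambda>y. ereal (g y) + convex_indicator X y)"
    and fstar: "(INF y. f y) = ereal fstar"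
    and F: "F = moreau_env (1 / (2 * \<rho>)) f"
    and c: "c > 0"
    and theta: "\<theta> \<in> {1 / 2 .. 1}"
    and KL: "\<And>y. y \<in> V \<Longrightarrow> norm (gradient F y) \<ge> c * (F y - fstar) powr \<theta>"
    and L: "L > 0"
    and P: "prob_space P"
    and G_meas: "(\<lambda>(y, z). G y z) \<in> borel_measurable (restrict_space borel X \<Otimes>\<^sub>M P)"
    and G_int: "\<And>y. y \<in> X \<Longrightarrow> integrable P (\<lambda>z. (norm (G y z))\<^sup>2)"
    and G_bound: "\<And>y. y \<in> X \<Longrightarrow> (\<integral>z. (norm (G y z))\<^sup>2 \<partial>P) \<le> L\<^sup>2"
    and G_subdiff: "\<And>y. y \<in> X \<Longrightarrow> (\<integral>z. G y z \<partial>P) \<in> frechet_subdiff g y"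
    and x0: "x\<^sub>0 \<in> X" "x\<^sub>0 \<in> V"
    and Delta: "\<Delta>\<^sub>0 = F x\<^sub>0 - fstar" "\<Delta>\<^sub>0 > 0"
    and C: "C = 16 * c powr (- 4) * \<Delta>\<^sub>0 powr (1 - 4 * \<theta>) * \<rho> * L\<^sup>2"
    and Nstar: "Nstar = (\<lambda>T. opt_outer \<Delta>\<^sub>0 C \<theta> T)"
    and N: "N = (\<lambda>T. nat \<lceil>Nstar T\<rceil>)"
    and t: "t = (\<lambda>T. nat \<lfloor>real T / real (N T)\<rfloor>)"
    and sampling: "\<And>T. T \<ge> 1 \<Longrightarrow> t T \<ge> 1 \<Longrightarrow> restart_sampling (M T) P (N T) (t T) (\<xi> T) (J T)"
    and x: "x = (\<lambda>T k \<omega>. restart_iter X G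
                   (\<lambda>y. sqrt (F y - fstar) / (sqrt \<rho> * L * sqrt (real (t T) + 1)))
                   x\<^sub>0 (\<lambda>i s. \<xi> T i s \<omega>) (\<lambda>i. J T i \<omega>) k)"
    and V: "\<And>T k. T \<ge> 1 \<Longrightarrow> t T \<ge> 1 \<Longrightarrow> k \<le> N T \<Longrightarrow> AE \<omega> in M T. x T k \<omega> \<in> V"
  shows "Nstar \<sim>[at_top] (\<lambda>T. ln (ln (real T / C)) / ln (4 * \<theta>))
    \<and> (\<forall>\<^sub>F T in at_top.
          integrable (M T) (\<lambda>\<omega>. F (x T (N T) \<omega>))
        \<and> integrable (M T) (\<lambda>\<omega>. (norm (gradient F (x T (N T) \<omega>)))\<^sup>2))
    \<and> asymp_le (\<lambda>T. (\<integral>\<omega>. F (x T (N T) \<omega>) \<partial>M T) - fstar)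
        (\<lambda>T. \<Delta>\<^sub>0 * (C * ln (ln (real T / C)) / (real T * ln (4 * \<theta>))) powr (1 / (4 * \<theta> - 1)))
    \<and> asymp_le (\<lambda>T. sqrt (\<integral>\<omega>. (norm (gradient F (x T (N T) \<omega>)))\<^sup>2 \<partial>M T))
        (\<lambda>T. norm (gradient F x\<^sub>0)
           * (C * ln (ln (real T / C)) / (real T * ln (4 * \<theta>))) powr (\<theta> / (4 * \<theta> - 1)))"
proof -
  have \<theta>: "\<theta> \<ge> 1/2" using theta by simp
  have lower: "fstar \<le> g y" if "y \<in> X" for y
  proof -
    have "ereal fstar \<le> f y" unfolding fstar[symmetric] by (rule INF_lower) simp
    then show ?thesis using that by (simp add: f convex_indicator_def)
  qed
  interpret W: weakly_convex_constrained g X \<rho> fstar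
    by unfold_locales (use rho g X lower in auto)
  have F_env: "F = W.env"
    unfolding F f by (rule W.moreau_env_eq)
  interpret S: stochastic_subgradient g X \<rho> fstar P G L
    by (intro stochastic_subgradient.intro stochastic_subgradient_axioms.intro
        W.weakly_convex_constrained_axioms P L G_meas G_int G_bound G_subdiff)
  have C0: "C > 0" using c Delta(2) rho L by (simp add: C)
  have N_opt: "N = (\<lambda>T. nat \<lceil>opt_outer \<Delta>\<^sub>0 C \<theta> T\<rceil>)"
    by (simp add: N Nstar)
  define R where "R T = (C * N T / T) powr ((1 - (4 * \<theta>) powr (- real (N T))) / (4 * \<theta> - 1))" for T
  define B where "B T = C * ln (ln (real T / C)) / (real T * ln (4 * \<theta>))" for T :: nat
  note asymp = opt_outer_asymp[OF Delta(2) C0 \<theta>, folded N_opt]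
  have R_asymp: "R \<sim>[at_top] (\<lambda>T. B T powr (1 / (4 * \<theta> - 1)))"
    using asymp(3) unfolding R_def[abs_def] B_def N_opt .
  have bounds: "integrable (M T) (\<lambda>\<omega>. F (x T (N T) \<omega>))
      \<and> integrable (M T) (\<lambda>\<omega>. (norm (gradient F (x T (N T) \<omega>)))\<^sup>2)
      \<and> (\<integral>\<omega>. F (x T (N T) \<omega>) \<partial>M T) - fstar \<le> \<Delta>\<^sub>0 * R T
      \<and> (\<integral>\<omega>. (norm (gradient F (x T (N T) \<omega>)))\<^sup>2 \<partial>M T) \<le> c\<^sup>2 * (\<Delta>\<^sub>0 * R T) powr (2 * \<theta>)"
    if NT: "1 \<le> N T" "N T \<le> T" for T
  proof -
    have T: "T \<ge> 1" using NT by simp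
    have t1: "t T \<ge> 1" unfolding t using NT by (simp add: le_nat_iff le_floor_iff pos_le_divide_eq)
    have sampling_T: "restart_sampling (M T) P (N T) (t T) (\<xi> T) (J T)"
      by (rule sampling[OF T t1])
    interpret PM: prob_space "M T" using sampling_T by (simp add: restart_sampling_def)
    interpret R: restart_scheme g X \<rho> fstar P G L "M T" "N T" "t T" "\<xi> T" "J T" x\<^sub>0
      by (intro restart_scheme.intro restart_scheme_axioms.intro S.stochastic_subgradient_axioms
          PM.prob_space_axioms sampling_T x0)
    have outer: "R.outer k \<omega> = x T k \<omega>" for k \<omega>
      by (simp add: R.outer_def x R.step_def[abs_def] F_env)
    \<comment> \<open>Although \<open>t T\<close> rounds \<open>T / N\<close> down, the average runs
      over \<open>t + 1\<close> iterates, at least \<open>T / N\<close>; the rounding costs no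
      factor.\<close>
    have "real T / real (N T) \<le> real (t T) + 1"
    proof -
      have "0 \<le> real T / real (N T)" by simp
      then show ?thesis unfolding t by linarith
    qed
    then have "C / (real (t T) + 1) \<le> C / (real T / real (N T))"
      using C0 NT by (intro divide_left_mono) auto
    then have b: "C / (real (t T) + 1) \<le> C * N T / T" by simp
    show ?thesis
      using R.expectation_outer_le[OF c \<theta> _ _ _ _ NT(1) b, of V] KL V[OF T t1] Delta C
      unfolding F_env R_def outer by simp
  qed
  have ev: "\<forall>\<^sub>F T in at_top. 1 \<le> N T \<and> N T \<le> T"
    using asymp(2) by (simp add: N_opt)
  have "asymp_le (\<lambda>T. (\<integral>\<omega>. F (x T (N T) \<omega>) \<partial>M T) - fstar) (\<lambda>T. \<Delta>\<^sub>0 * B T powr (1 / (4 * \<theta> - 1)))"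
    unfolding asymp_le_def
  proof (intro exI conjI)
    show "(\<lambda>T. \<Delta>\<^sub>0 * R T) \<sim>[at_top] (\<lambda>T. \<Delta>\<^sub>0 * B T powr (1 / (4 * \<theta> - 1)))"
      by (intro asymp_equiv_mult asymp_equiv_refl R_asymp)
    show "\<forall>\<^sub>F T in at_top. (\<integral>\<omega>. F (x T (N T) \<omega>) \<partial>M T) - fstar \<le> \<Delta>\<^sub>0 * R T"
      using ev by eventually_elim (use bounds in blast)
  qed
  moreover have "asymp_le (\<lambda>T. sqrt (\<integral>\<omega>. (norm (gradient F (x T (N T) \<omega>)))\<^sup>2 \<partial>M T))
      (\<lambda>T. norm (gradient F x\<^sub>0) * B T powr (\<theta> / (4 * \<theta> - 1)))"
    unfolding asymp_le_def
  proof (intro exI conjI)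
    have "(\<lambda>T. R T powr \<theta>) \<sim>[at_top] (\<lambda>T. (B T powr (1 / (4 * \<theta> - 1))) powr \<theta>)"
      by (intro asymp_equiv_powr_real R_asymp) (auto simp: R_def)
    then show "(\<lambda>T. norm (gradient F x\<^sub>0) * R T powr \<theta>)
        \<sim>[at_top] (\<lambda>T. norm (gradient F x\<^sub>0) * B T powr (\<theta> / (4 * \<theta> - 1)))"
      by (intro asymp_equiv_mult asymp_equiv_refl) (simp add: powr_powr)
    show "\<forall>\<^sub>F T in at_top. sqrt (\<integral>\<omega>. (norm (gradient F (x T (N T) \<omega>)))\<^sup>2 \<partial>M T)
        \<le> norm (gradient F x\<^sub>0) * R T powr \<theta>"
      using ev
    proof eventually_elim
      case (elim T)
      have R0: "R T \<ge> 0" by (simp add: R_def)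
      have "sqrt (\<integral>\<omega>. (norm (gradient F (x T (N T) \<omega>)))\<^sup>2 \<partial>M T) \<le> sqrt (c\<^sup>2 * (\<Delta>\<^sub>0 * R T) powr (2 * \<theta>))"
        using bounds[of T] elim by (intro real_sqrt_le_mono) blast
      also have "\<dots> = c * ((\<Delta>\<^sub>0 * R T) powr (2 * \<theta>)) powr (1 / 2)"
        using c by (simp add: real_sqrt_mult powr_half_sqrt)
      also have "\<dots> = (c * \<Delta>\<^sub>0 powr \<theta>) * R T powr \<theta>"
        using R0 Delta(2) by (simp add: powr_powr powr_mult)
      \<comment> \<open>The Lojasiewicz inequality at the starting point, \<open>c *
        \<Delta>\<^sub>0 powr \<theta> \<le> norm (gradient F x\<^sub>0)\<close>, brings in the
        initial gradient norm.\<close>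
      also have "\<dots> \<le> norm (gradient F x\<^sub>0) * R T powr \<theta>"
        using KL[OF x0(2)] by (intro mult_right_mono) (auto simp: Delta(1))
      finally show ?case .
    qed
  qed
  moreover have "\<forall>\<^sub>F T in at_top. integrable (M T) (\<lambda>\<omega>. F (x T (N T) \<omega>))
        \<and> integrable (M T) (\<lambda>\<omega>. (norm (gradient F (x T (N T) \<omega>)))\<^sup>2)"
    using ev by eventually_elim (use bounds in blast)
  ultimately show ?thesis
    using asymp(1) unfolding B_def Nstar by simp
qed

end
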